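(* Assume (A1) and (A2). Let $(\boldsymbol\pi,\boldsymbol\mu)$ be a GMFE such that for all $t,x,u$ the map $\alpha\mapsto\pi^\alpha_t(u\mid x)$ is Lipschitz on $\mathcal I$ except at finitely many points. Then for any $\varepsilon,p>0$ there exists $N'$ such that for all $N>N'$ the policy tuple $(\pi^1,\dots,\pi^N)=\Gamma_N(\boldsymbol\pi)\in\Pi^N$ is an $(\varepsilon,p)$-Markov–Nash equilibrium of the $N$-agent game.
   Context: Setting: finite $\mathcal X,\mathcal U$; $\mathcal T=\{0,\dots,T-1\}$; $\mathcal I=[0,1]$; $\mathcal P(\cdot)$, $\mathcal B(\cdot)$ probability resp. bounded nonnegative measures (vectors with $\ell_1$ norm); kernel $P:\mathcal X\times\mathcal U\times\mathcal B(\mathcal X)\to\mathcal P(\mathcal X)$, reward $r:\mathcal X\times\mathcal U\times\mathcal B(\mathcal X)\to\mathbb R$, initial law $\mu_0$; graphon $W:[0,1]^2\to[0,\infty)$ symmetric measurable integrable. Policies $\Pi=\mathcal P(\mathcal U)^{\mathcal T\times\mathcal X}$; policy ensembles $\boldsymbol\Pi$, mean field ensembles $\boldsymbol{\mathcal M}$: families indexed by $\alpha\in\mathcal I$, measurable in $\alpha$. $\mathbb G^\alpha(\boldsymbol\mu_t)=\int W(\alpha,\beta)\mu^\beta_td\beta$; $\Psi(\boldsymbol\pi)$: $\mu^\alpha_0=\mu_0$, $\mu^\alpha_{t+1}(x)=\sum_{x'}\mu^\alpha_t(x')\sum_u\pi^\alpha_t(u\mid x')P(x\mid x',u,\mathbb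 G^\alpha(\boldsymbol\mu_t))$. $J^{\boldsymbol\mu}_\alpha(\pi)=\mathbb E[\sum_{t<T}r(X_t,U_t,\mathbb G^\alpha(\boldsymbol\mu_t))]$ with $X_0\sim\mu_0$, $U_t\sim\pi_t(\cdot\mid X_t)$, $X_{t+1}\sim P(\cdot\mid X_t,U_t,\mathbb G^\alpha(\boldsymbol\mu_t))$. GMFE: $(\boldsymbol\pi,\boldsymbol\mu)$ with $\boldsymbol\mu=\Psi(\boldsymbol\pi)$ and $\pi^\alpha\in\arg\max_\pi J^{\boldsymbol\mu}_\alpha(\pi)$ for all $\alpha$. Finite game: graphs $G_N=(V_N,E_N)$, $V_N=\{1,\dots,N\}$, $\rho_N>0$, $\rho_N=\Theta(|E_N|/N^2)$, step graphon $W_N(x,y)=\mathbf 1\{\{\lceil Nx\rceil,\lceil Ny\rceil\}\in E_N\}$; under $(\pi^1,\dots,\pi^N)$: $X^i_0\sim\mu_0$ i.i.d., $U^i_t\sim\pi^i_t(\cdot\mid X^i_t)$, $X^i_{t+1}\sim P(\cdot\mid X^i_t,U^i_t,\mathbb G^i_t)$ conditionally independent, $\mathbb G^i_t=\frac1{N\rho_N}\sum_j\mathbf 1_{\{ij\in E_N\}}\delta_{X^j_t}$; $J^N_i(\pi^1,\dots,\pi^N)=\mathbb E[\sum_{t<T}r(X^i_t,U^i_t,\mathbb G^i_t)]$. $\Gamma_N(\boldsymbol\pi)=(\pi^{1/N},\dots,\pi^{N/N})$. An $(\varepsilon,p)$-Markov–Nash equilibrium is $(\pi^1,\dots,\pi^N)$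 such that for some $\mathcal W_N\subseteq V_N$ with $|\mathcal W_N|\ge\lfloor(1-p)N\rfloor$ and all $i\in\mathcal W_N$: $J^N_i(\pi^1,\dots,\pi^N)\ge\sup_{\pi\in\Pi}J^N_i(\pi^1,\dots,\pi^{i-1},\pi,\pi^{i+1},\dots,\pi^N)-\varepsilon$. (A1): $\|\rho_N^{-1}W_N-W\|_\square\to0$ and $\|\rho_N^{-1}W_N-W\|_{L_\infty\to L_1}\to0$ (cut norm $\sup_{S,T}|\int_{S\times T}U|$; $\|U\|_{L_\infty\to L_1}=\sup_{\|g\|_\infty\le1}\int|\int U(\alpha,\beta)g(\beta)d\beta|d\alpha$). (A2): $r,P$ are Lipschitz, and either $W$ is Lipschitz, or there are $L_W>0$ and disjoint intervals $\mathcal I_1,\dots,\mathcal I_Q$ covering $\mathcal I$ with $|W(x,y)-W(\tilde x,\tilde y)|\le L_W(|x-\tilde x|+|y-\tilde y|)$ for all $(x,y),(\tilde x,\tilde y)\in\mathcal I_i\times\mathcal I_j$, all $i,j$. *)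

theory Defs
  imports "HOL-Analysis.Analysis" "HOL-Probability.Probability" "HOL-Library.Landau_Symbols"
begin

(* States 'x and actions 'u are finite types.  Bounded nonnegative measures on 'x are
   functions 'x => real (nonnegative); probability measures are 'x pmf.
   A policy is  nat => 'x => 'u pmf  (time, state), a policy ensemble is
   real => nat => 'x => 'u pmf (alpha, time, state), a mean field ensemble is
   nat => real => 'x => real (time, alpha, state). *)

definition graphon_agg ::
  "(real \<Rightarrow> real \<Rightarrow> real) \<Rightarrow> (real \<Rightarrow> 'x \<Rightarrow> real) \<Rightarrow> real \<Rightarrow> 'x \<Rightarrow> real" where
  "graphon_agg W m \<alpha> = (\<lambda>x. set_lebesgue_integral lborel {0..1} (\<lambda>\<beta>. W \<alpha> \<beta> * m \<beta> x))"

primrec mf_flow ::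
  "('x::finite \<Rightarrow> 'u::finite \<Rightarrow> ('x \<Rightarrow> real) \<Rightarrow> 'x pmf) \<Rightarrow> 'x pmf \<Rightarrow>
   (real \<Rightarrow> real \<Rightarrow> real) \<Rightarrow> (real \<Rightarrow> nat \<Rightarrow> 'x \<Rightarrow> 'u pmf) \<Rightarrow> nat \<Rightarrow> real \<Rightarrow> 'x \<Rightarrow> real" where
  "mf_flow P mu0 W \<pi>e 0 = (\<lambda>\<alpha> x. pmf mu0 x)"
| "mf_flow P mu0 W \<pi>e (Suc t) = (\<lambda>\<alpha> x.
     (\<Sum>x'\<in>UNIV. mf_flow P mu0 W \<pi>e t \<alpha> x' *
        (\<Sum>u\<in>UNIV. pmf (\<pi>e \<alpha> t x') u *
           pmf (P x' u (graphon_agg W (mf_flow P mu0 W \<pi>e t) \<alpha>)) x)))"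

primrec agent_law ::
  "('x::finite \<Rightarrow> 'u::finite \<Rightarrow> ('x \<Rightarrow> real) \<Rightarrow> 'x pmf) \<Rightarrow> 'x pmf \<Rightarrow>
   (real \<Rightarrow> real \<Rightarrow> real) \<Rightarrow> (nat \<Rightarrow> real \<Rightarrow> 'x \<Rightarrow> real) \<Rightarrow> real \<Rightarrow>
   (nat \<Rightarrow> 'x \<Rightarrow> 'u pmf) \<Rightarrow> nat \<Rightarrow> 'x pmf" where
  "agent_law P mu0 W mu \<alpha> pol 0 = mu0"
| "agent_law P mu0 W mu \<alpha> pol (Suc t) =
     bind_pmf (agent_law P mu0 W mu \<alpha> pol t)
       (\<lambda>x. bind_pmf (pol t x) (\<lambda>u. P x u (graphon_agg W (mu t) \<alpha>)))"

definition mf_return ::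
  "('x::finite \<Rightarrow> 'u::finite \<Rightarrow> ('x \<Rightarrow> real) \<Rightarrow> 'x pmf) \<Rightarrow>
   ('x \<Rightarrow> 'u \<Rightarrow> ('x \<Rightarrow> real) \<Rightarrow> real) \<Rightarrow> 'x pmf \<Rightarrow>
   (real \<Rightarrow> real \<Rightarrow> real) \<Rightarrow> nat \<Rightarrow> (nat \<Rightarrow> real \<Rightarrow> 'x \<Rightarrow> real) \<Rightarrow> real \<Rightarrow>
   (nat \<Rightarrow> 'x \<Rightarrow> 'u pmf) \<Rightarrow> real" where
  "mf_return P r mu0 W T mu \<alpha> pol =
     (\<Sum>t<T. measure_pmf.expectation (agent_law P mu0 W mu \<alpha> pol t)
        (\<lambda>x. measure_pmf.expectation (pol t x) (\<lambda>u. r x u (graphon_agg W (mu t) \<alpha>))))"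

definition is_GMFE ::
  "('x::finite \<Rightarrow> 'u::finite \<Rightarrow> ('x \<Rightarrow> real) \<Rightarrow> 'x pmf) \<Rightarrow>
   ('x \<Rightarrow> 'u \<Rightarrow> ('x \<Rightarrow> real) \<Rightarrow> real) \<Rightarrow> 'x pmf \<Rightarrow>
   (real \<Rightarrow> real \<Rightarrow> real) \<Rightarrow> nat \<Rightarrow> (real \<Rightarrow> nat \<Rightarrow> 'x \<Rightarrow> 'u pmf) \<Rightarrow>
   (nat \<Rightarrow> real \<Rightarrow> 'x \<Rightarrow> real) \<Rightarrow> bool" where
  "is_GMFE P r mu0 W T \<pi>e mu \<longleftrightarrow>
     (\<forall>t. \<forall>\<alpha>\<in>{0..1}. mu t \<alpha> = mf_flow P mu0 W \<pi>e t \<alpha>) \<and>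
     (\<forall>\<alpha>\<in>{0..1}. \<forall>pol. mf_return P r mu0 W T mu \<alpha> pol \<le> mf_return P r mu0 W T mu \<alpha> (\<pi>e \<alpha>))"

definition policy_ensemble :: "(real \<Rightarrow> nat \<Rightarrow> 'x \<Rightarrow> 'u pmf) \<Rightarrow> bool" where
  "policy_ensemble \<pi>e \<longleftrightarrow>
     (\<forall>t x u. set_borel_measurable lborel {0..1} (\<lambda>\<alpha>. pmf (\<pi>e \<alpha> t x) u))"

definition emp_nbhd ::
  "(nat \<Rightarrow> nat \<Rightarrow> bool) \<Rightarrow> real \<Rightarrow> nat \<Rightarrow> (nat \<Rightarrow> 'x) \<Rightarrow> nat \<Rightarrow> 'x \<Rightarrow> real" where
  "emp_nbhd E rhoN N X i = (\<lambda>x.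
     (\<Sum>j\<in>{1..N}. (if E i j \<and> X j = x then 1 else 0)) / (real N * rhoN))"

primrec joint_law ::
  "('x::finite \<Rightarrow> 'u::finite \<Rightarrow> ('x \<Rightarrow> real) \<Rightarrow> 'x pmf) \<Rightarrow> 'x pmf \<Rightarrow>
   (nat \<Rightarrow> nat \<Rightarrow> bool) \<Rightarrow> real \<Rightarrow> nat \<Rightarrow> (nat \<Rightarrow> nat \<Rightarrow> 'x \<Rightarrow> 'u pmf) \<Rightarrow>
   nat \<Rightarrow> (nat \<Rightarrow> 'x) pmf" where
  "joint_law P mu0 E rhoN N pis 0 = Pi_pmf {1..N} undefined (\<lambda>i. mu0)"
| "joint_law P mu0 E rhoN N pis (Suc t) =
     bind_pmf (joint_law P mu0 E rhoN N pis t)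
       (\<lambda>X. Pi_pmf {1..N} undefined
              (\<lambda>i. bind_pmf (pis i t (X i)) (\<lambda>u. P (X i) u (emp_nbhd E rhoN N X i))))"

definition game_return ::
  "('x::finite \<Rightarrow> 'u::finite \<Rightarrow> ('x \<Rightarrow> real) \<Rightarrow> 'x pmf) \<Rightarrow>
   ('x \<Rightarrow> 'u \<Rightarrow> ('x \<Rightarrow> real) \<Rightarrow> real) \<Rightarrow> 'x pmf \<Rightarrow>
   (nat \<Rightarrow> nat \<Rightarrow> bool) \<Rightarrow> real \<Rightarrow> nat \<Rightarrow> nat \<Rightarrow>
   (nat \<Rightarrow> nat \<Rightarrow> 'x \<Rightarrow> 'u pmf) \<Rightarrow> nat \<Rightarrow> real" where
  "game_return P r mu0 E rhoN N T pis i =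
     (\<Sum>t<T. measure_pmf.expectation (joint_law P mu0 E rhoN N pis t)
        (\<lambda>X. measure_pmf.expectation (pis i t (X i))
               (\<lambda>u. r (X i) u (emp_nbhd E rhoN N X i))))"

definition markov_nash ::
  "('x::finite \<Rightarrow> 'u::finite \<Rightarrow> ('x \<Rightarrow> real) \<Rightarrow> 'x pmf) \<Rightarrow>
   ('x \<Rightarrow> 'u \<Rightarrow> ('x \<Rightarrow> real) \<Rightarrow> real) \<Rightarrow> 'x pmf \<Rightarrow>
   (nat \<Rightarrow> nat \<Rightarrow> bool) \<Rightarrow> real \<Rightarrow> nat \<Rightarrow> nat \<Rightarrow> real \<Rightarrow> real \<Rightarrow>
   (nat \<Rightarrow> nat \<Rightarrow> 'x \<Rightarrow> 'u pmf) \<Rightarrow> bool" where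
  "markov_nash P r mu0 E rhoN N T \<epsilon> p pis \<longleftrightarrow>
     (\<exists>WN \<subseteq> {1..N}. real (card WN) \<ge> of_int \<lfloor>(1 - p) * real N\<rfloor> \<and>
        (\<forall>i\<in>WN. \<forall>pol.
           game_return P r mu0 E rhoN N T pis i \<ge>
           game_return P r mu0 E rhoN N T (pis(i := pol)) i - \<epsilon>))"

definition Gamma_N :: "nat \<Rightarrow> (real \<Rightarrow> nat \<Rightarrow> 'x \<Rightarrow> 'u pmf) \<Rightarrow> nat \<Rightarrow> nat \<Rightarrow> 'x \<Rightarrow> 'u pmf" where
  "Gamma_N N \<pi>e = (\<lambda>i. \<pi>e (real i / real N))"

definition step_graphon :: "(nat \<Rightarrow> nat \<Rightarrow> bool) \<Rightarrow> nat \<Rightarrow> real \<Rightarrow> real \<Rightarrow> real" where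
  "step_graphon E N x y =
     (if E (nat \<lceil>real N * x\<rceil>) (nat \<lceil>real N * y\<rceil>) then 1 else 0)"

definition num_edges :: "(nat \<Rightarrow> nat \<Rightarrow> bool) \<Rightarrow> nat \<Rightarrow> nat" where
  "num_edges E N = card {(i, j). i \<in> {1..N} \<and> j \<in> {1..N} \<and> i < j \<and> E i j}"

definition cut_norm :: "(real \<Rightarrow> real \<Rightarrow> real) \<Rightarrow> real" where
  "cut_norm U = (SUP ST \<in> {(S, T). S \<in> sets lborel \<and> T \<in> sets lborel \<and>
                                    S \<subseteq> {0..1} \<and> T \<subseteq> {0..1}}.
      \<bar>set_lebesgue_integral (lborel \<Otimes>\<^sub>M lborel) (fst ST \<times> snd ST) (\<lambda>(x, y). U x y)\<bar>)"

definition linf_l1_norm :: "(real \<Rightarrow> real \<Rightarrow> real) \<Rightarrow> real" where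
  "linf_l1_norm U = (SUP g \<in> {g. g \<in> borel_measurable lborel \<and> (\<forall>\<beta>. \<bar>g \<beta>\<bar> \<le> 1)}.
      set_lebesgue_integral lborel {0..1}
        (\<lambda>\<alpha>. \<bar>set_lebesgue_integral lborel {0..1} (\<lambda>\<beta>. U \<alpha> \<beta> * g \<beta>)\<bar>))"

definition is_graphon :: "(real \<Rightarrow> real \<Rightarrow> real) \<Rightarrow> bool" where
  "is_graphon W \<longleftrightarrow>
     (\<forall>x\<in>{0..1}. \<forall>y\<in>{0..1}. W x y \<ge> 0 \<and> W x y = W y x) \<and>
     set_borel_measurable (lborel \<Otimes>\<^sub>M lborel) ({0..1} \<times> {0..1}) (\<lambda>(x, y). W x y) \<and>
     set_integrable (lborel \<Otimes>\<^sub>M lborel) ({0..1} \<times> {0..1}) (\<lambda>(x, y). W x y)"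

definition graphon_piecewise_lipschitz :: "(real \<Rightarrow> real \<Rightarrow> real) \<Rightarrow> bool" where
  "graphon_piecewise_lipschitz W \<longleftrightarrow>
     (\<exists>L. \<forall>x\<in>{0..1}. \<forall>y\<in>{0..1}. \<forall>x'\<in>{0..1}. \<forall>y'\<in>{0..1}.
         \<bar>W x y - W x' y'\<bar> \<le> L * (\<bar>x - x'\<bar> + \<bar>y - y'\<bar>)) \<or>
     (\<exists>LW > 0. \<exists>Q::nat. \<exists>Iv :: nat \<Rightarrow> real set.
         (\<forall>i<Q. is_interval (Iv i)) \<and>
         (\<forall>i<Q. \<forall>j<Q. i \<noteq> j \<longrightarrow> Iv i \<inter> Iv j = {}) \<and>
         (\<Union>i<Q. Iv i) = {0..1} \<and>
         (\<forall>i<Q. \<forall>j<Q. \<forall>x\<in>Iv i. \<forall>x'\<in>Iv i. \<forall>y\<in>Iv j. \<forall>y'\<in>Iv j.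
            \<bar>W x y - W x' y'\<bar> \<le> LW * (\<bar>x - x'\<bar> + \<bar>y - y'\<bar>)))"

definition reward_lipschitz :: "('x::finite \<Rightarrow> 'u \<Rightarrow> ('x \<Rightarrow> real) \<Rightarrow> real) \<Rightarrow> bool" where
  "reward_lipschitz r \<longleftrightarrow> (\<exists>L. \<forall>x u g g'. (\<forall>y. g y \<ge> 0) \<longrightarrow> (\<forall>y. g' y \<ge> 0) \<longrightarrow>
      \<bar>r x u g - r x u g'\<bar> \<le> L * (\<Sum>y\<in>UNIV. \<bar>g y - g' y\<bar>))"

definition kernel_lipschitz :: "('x::finite \<Rightarrow> 'u \<Rightarrow> ('x \<Rightarrow> real) \<Rightarrow> 'x pmf) \<Rightarrow> bool" where
  "kernel_lipschitz P \<longleftrightarrow> (\<exists>L. \<forall>x u g g'. (\<forall>y. g y \<ge> 0) \<longrightarrow> (\<forall>y. g' y \<ge> 0) \<longrightarrow>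
      (\<Sum>z\<in>UNIV. \<bar>pmf (P x u g) z - pmf (P x u g') z\<bar>) \<le> L * (\<Sum>y\<in>UNIV. \<bar>g y - g' y\<bar>))"

definition lipschitz_except_finite :: "(real \<Rightarrow> real) \<Rightarrow> bool" where
  "lipschitz_except_finite f \<longleftrightarrow>
     (\<exists>D L. finite D \<and> D \<subseteq> {0..1} \<and>
        (\<forall>a\<in>{0..1}. \<forall>b\<in>{0..1}. {min a b..max a b} \<inter> D = {} \<longrightarrow>
            \<bar>f a - f b\<bar> \<le> L * \<bar>a - b\<bar>))"

end

theory Submission
  imports Defs
begin

text \<open>
  Write \<open>A k j = 1{k ~ j} / (N \<rho>)\<close> and \<open>\<theta> = 1 / (N \<rho>)\<close>. Tested against step functions, the
  \<open>L\<^sub>\<infinity> \<rightarrow> L\<^sub>1\<close> convergence says that for every configuration \<open>s\<close> of the agents the graph aggregates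
  \<open>\<Sum>j. A k j * s j\<close> are close, on average over \<open>k\<close>, to the graphon aggregates of \<open>s\<close>. Applied to
  \<open>s = 1\<close> it bounds the rescaled degrees of all but a few vertices and the mass sitting on the
  exceptional ones; applied to random signs it forces \<open>\<theta> \<rightarrow> 0\<close>; applied to the mean field, which is
  continuous in \<open>\<alpha>\<close> up to finitely many points, it identifies the limiting aggregates.

  The game in which one agent deviates is coupled step by step, by maximal couplings, to independent
  agents that see the limiting aggregates. The probability that agent \<open>k\<close> has decoupled satisfies a linear
  recursion driven by \<open>A\<close>, and the deviating agent enters it only through \<open>A k i \<le> \<theta>\<close>. The
  resulting bound therefore depends neither on the deviator nor on its policy, and its average over
  \<open>k\<close> tends to \<open>0\<close>. By Markov's inequality the returns of most agents are uniformly close to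
  their mean field returns, for which the equilibrium policy is optimal.
\<close>

section \<open>Independent families and maximal couplings\<close>

text \<open>The set of agents that satisfy the equilibrium inequality is fixed before the deviating
  policy is chosen; this is why all estimates must be uniform over deviators and policies.
  Convergence in operator norm controls only averages over vertices: a single vertex may have a huge
  degree, so some agents have to be given up, although they still act on the others. Symmetry of the
  graph turns bounds on rows of \<open>A\<close> into bounds on columns, and this lets the error
  recursion close after averaging.

  Divergence of \<open>N * rho N\<close> is not among the assumptions and has to be extracted. A
  vertex with few neighbours cannot average out random signs as an integral operator with bounded
  kernel does, and the relation between \<open>rho\<close> and the edge count guarantees that a
  positive fraction of the vertices has neighbours at all.

  Agents sit on the grid \<open>k / N\<close>, a null set, where measurability in \<alpha> says
  nothing. Continuity off a finite set is what lets dominated convergence compare grid values with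
  integrals.\<close>

lemma expectation_bind_pmf_finite:
  fixes h :: "'b \<Rightarrow> real"
  assumes "finite (set_pmf p)" "\<And>x. x \<in> set_pmf p \<Longrightarrow> finite (set_pmf (f x))"
  shows "measure_pmf.expectation (bind_pmf p f) h
    = measure_pmf.expectation p (\<lambda>x. measure_pmf.expectation (f x) h)"
proof -
  have "measure_pmf.expectation (bind_pmf p f) h
      = (\<Sum>a\<in>set_pmf p. pmf p a *\<^sub>R measure_pmf.expectation (f a) h)"
    using assms by (intro pmf_expectation_bind) auto
  also have "\<dots> = measure_pmf.expectation p (\<lambda>x. measure_pmf.expectation (f x) h)"
    using assms by (intro integral_measure_pmf[symmetric]) auto
  finally show ?thesis .
qed

lemma finite_set_Pi_pmf:
  fixes q :: "'i \<Rightarrow> 'a::finite pmf"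
  assumes "finite A"
  shows "finite (set_pmf (Pi_pmf A d q))"
  by (rule finite_subset[OF set_Pi_pmf_subset'[OF assms]]) (use assms in \<open>auto intro!: finite_PiE_dflt\<close>)

lemma expectation_Pi_pmf_component:
  assumes "finite A" "j \<in> A"
  shows "measure_pmf.expectation (Pi_pmf A d q) (\<lambda>X. f (X j)) = measure_pmf.expectation (q j) (f :: _ \<Rightarrow> real)"
proof -
  have "measure_pmf.expectation (q j) f
      = measure_pmf.expectation (map_pmf (\<lambda>X. X j) (Pi_pmf A d q)) f"
    using assms by (simp add: Pi_pmf_component)
  then show ?thesis by (simp add: integral_map_pmf)
qed

lemma expectation_Pi_pmf_mult:
  fixes q :: "'i \<Rightarrow> 'a::finite pmf" and f g :: "'a \<Rightarrow> real"
  assumes "finite A" "j \<in> A" "l \<in> A" "j \<noteq> l"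
  shows "measure_pmf.expectation (Pi_pmf A d q) (\<lambda>X. f (X j) * g (X l))
    = measure_pmf.expectation (q j) f * measure_pmf.expectation (q l) g"
proof -
  define B where "B = A - {j}"
  have B: "finite B" "j \<notin> B" "l \<in> B" "A = insert j B" using assms by (auto simp: B_def)
  have "measure_pmf.expectation (Pi_pmf A d q) (\<lambda>X. f (X j) * g (X l))
     = measure_pmf.expectation (pair_pmf (q j) (Pi_pmf B d q)) (\<lambda>(y, X). f y * g (X l))"
    using assms(4) unfolding B(4)
    by (subst Pi_pmf_insert[OF B(1,2)]) (simp add: integral_map_pmf case_prod_unfold)
  also have "\<dots> = measure_pmf.expectation (q j) (\<lambda>y. measure_pmf.expectation (Pi_pmf B d q) (\<lambda>X. f y * g (X l)))"
    unfolding pair_pmf_def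
    by (simp add: expectation_bind_pmf_finite finite_set_Pi_pmf[OF B(1)])
  also have "\<dots> = measure_pmf.expectation (q j) f * measure_pmf.expectation (q l) g"
    by (simp add: expectation_Pi_pmf_component[OF B(1,3)])
  finally show ?thesis .
qed

lemma expectation_abs_le_sqrt:
  fixes f :: "'a \<Rightarrow> real"
  assumes "finite (set_pmf p)"
  shows "measure_pmf.expectation p (\<lambda>x. \<bar>f x\<bar>) \<le> sqrt (measure_pmf.expectation p (\<lambda>x. (f x)\<^sup>2))"
proof (rule real_le_rsqrt)
  have "measure_pmf.expectation p (\<lambda>x. (\<bar>f x\<bar> - measure_pmf.expectation p (\<lambda>x. \<bar>f x\<bar>))\<^sup>2) \<ge> 0"
    by (rule Bochner_Integration.integral_nonneg) simp
  moreover have "measure_pmf.expectation p (\<lambda>x. (\<bar>f x\<bar> - measure_pmf.expectation p (\<lambda>x. \<bar>f x\<bar>))\<^sup>2)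
     = measure_pmf.expectation p (\<lambda>x. \<bar>f x\<bar>\<^sup>2) - (measure_pmf.expectation p (\<lambda>x. \<bar>f x\<bar>))\<^sup>2"
    by (rule measure_pmf.variance_eq) (simp_all add: integrable_measure_pmf_finite[OF assms])
  ultimately show "(measure_pmf.expectation p (\<lambda>x. \<bar>f x\<bar>))\<^sup>2 \<le> measure_pmf.expectation p (\<lambda>x. (f x)\<^sup>2)"
    by simp
qed

text \<open>Second moment method: independence and zero means remove the off-diagonal terms of the
  square, and the diagonal ones are at most \<open>(w j)\<^sup>2\<close>. It serves twice: for
  random signs under the graphon operator and for the sampling noise of independent agents.\<close>

lemma expectation_Pi_pmf_abs_sum_le:
  fixes q :: "'i \<Rightarrow> 'a::finite pmf" and f :: "'i \<Rightarrow> 'a \<Rightarrow> real" and w :: "'i \<Rightarrow> real"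
  assumes A: "finite A"
    and mean: "\<And>j. j \<in> A \<Longrightarrow> measure_pmf.expectation (q j) (f j) = 0"
    and bnd: "\<And>j a. j \<in> A \<Longrightarrow> \<bar>f j a\<bar> \<le> 1"
  shows "measure_pmf.expectation (Pi_pmf A d q) (\<lambda>X. \<bar>\<Sum>j\<in>A. w j * f j (X j)\<bar>) \<le> sqrt (\<Sum>j\<in>A. (w j)\<^sup>2)"
proof -
  let ?E = "measure_pmf.expectation (Pi_pmf A d q)"
  note int = integrable_measure_pmf_finite[OF finite_set_Pi_pmf[OF A]]
  have cross: "?E (\<lambda>X. (w j * f j (X j)) * (w l * f l (X l))) \<le> (if j = l then (w j)\<^sup>2 else 0)"
    if "j \<in> A" "l \<in> A" for j l
  proof (cases "j = l")
    case True
    have "?E (\<lambda>X. (w j * f j (X j)) * (w l * f l (X l))) \<le> ?E (\<lambda>X. (w j)\<^sup>2)"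
    proof (intro integral_mono int)
      fix X
      have "(f j (X j))\<^sup>2 \<le> 1" using bnd[OF that(1), of "X j"] by (simp add: abs_square_le_1)
      then have "(w j)\<^sup>2 * (f j (X j))\<^sup>2 \<le> (w j)\<^sup>2 * 1" by (intro mult_left_mono) auto
      then show "(w j * f j (X j)) * (w l * f l (X l)) \<le> (w j)\<^sup>2"
        using True by (simp add: power2_eq_square algebra_simps)
    qed
    then show ?thesis using True by simp
  next
    case False
    have "?E (\<lambda>X. (w j * f j (X j)) * (w l * f l (X l)))
       = measure_pmf.expectation (q j) (\<lambda>a. w j * f j a) * measure_pmf.expectation (q l) (\<lambda>a. w l * f l a)"
      by (rule expectation_Pi_pmf_mult[OF A that False])
    also have "\<dots> = 0" using mean[OF that(1)] by simp
    finally show ?thesis using False by simp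
  qed
  have "?E (\<lambda>X. (\<Sum>j\<in>A. w j * f j (X j))\<^sup>2)
     = (\<Sum>j\<in>A. \<Sum>l\<in>A. ?E (\<lambda>X. (w j * f j (X j)) * (w l * f l (X l))))"
    by (simp add: power2_eq_square sum_product Bochner_Integration.integral_sum int)
  also have "\<dots> \<le> (\<Sum>j\<in>A. \<Sum>l\<in>A. if j = l then (w j)\<^sup>2 else 0)"
    by (intro sum_mono cross)
  also have "\<dots> = (\<Sum>j\<in>A. (w j)\<^sup>2)" using A by simp
  finally have "?E (\<lambda>X. (\<Sum>j\<in>A. w j * f j (X j))\<^sup>2) \<le> (\<Sum>j\<in>A. (w j)\<^sup>2)" .
  then have "sqrt (?E (\<lambda>X. (\<Sum>j\<in>A. w j * f j (X j))\<^sup>2)) \<le> sqrt (\<Sum>j\<in>A. (w j)\<^sup>2)"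
    by simp
  with expectation_abs_le_sqrt[OF finite_set_Pi_pmf[OF A]] show ?thesis
    by (rule order_trans)
qed

text \<open>Keep the common mass on the diagonal and distribute the two remainders independently.
  The stated bound is twice the total variation distance, which costs only a constant later.\<close>

lemma maximal_coupling:
  fixes p q :: "'a::finite pmf"
  shows "\<exists>w. map_pmf fst w = p \<and> map_pmf snd w = q \<and>
    measure_pmf.prob w {z. fst z \<noteq> snd z} \<le> (\<Sum>a\<in>UNIV. \<bar>pmf p a - pmf q a\<bar>)"
proof (cases "p = q")
  \<comment> \<open>Treated apart because the remainders vanish here and the normalization by
    \<open>\<delta>\<close> below would divide by 0.\<close>
  case True
  let ?w = "map_pmf (\<lambda>a. (a, a)) p"
  have "map_pmf fst ?w = p" "map_pmf snd ?w = q"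
    using True by (simp_all add: pmf.map_comp o_def)
  moreover have "measure_pmf.prob ?w {z. fst z \<noteq> snd z} = 0"
    by (simp add: vimage_def)
  ultimately show ?thesis by (metis (mono_tags, lifting) abs_ge_zero sum_nonneg)
next
  case False
  define m where "m a = min (pmf p a) (pmf q a)" for a
  define \<delta> where "\<delta> = 1 - (\<Sum>a\<in>UNIV. m a)"
  have sp: "(\<Sum>a\<in>UNIV. pmf p a) = 1" and sq: "(\<Sum>a\<in>UNIV. pmf q a) = 1"
    by (simp_all add: sum_pmf_eq_1)
  have dp: "(\<Sum>a\<in>UNIV. pmf p a - m a) = \<delta>" and dq: "(\<Sum>a\<in>UNIV. pmf q a - m a) = \<delta>"
    by (simp_all add: sum_subtractf sp sq \<delta>_def)
  have m: "m a \<le> pmf p a" "m a \<le> pmf q a" "0 \<le> m a" for a by (simp_all add: m_def)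
  have "\<delta> > 0"
  proof (rule ccontr)
    assume "\<not> \<delta> > 0"
    moreover have "0 \<le> (\<Sum>a\<in>UNIV. pmf p a - m a)" by (intro sum_nonneg) (simp add: m)
    ultimately have d0: "\<delta> = 0" using dp by simp
    have "pmf p a = m a" for a
      using dp unfolding d0 by (subst (asm) sum_nonneg_eq_0_iff) (auto simp: m)
    moreover have "pmf q a = m a" for a
      using dq unfolding d0 by (subst (asm) sum_nonneg_eq_0_iff) (auto simp: m)
    ultimately show False using False by (auto intro: pmf_eqI)
  qed
  \<comment> \<open>Both remainders have total mass \<open>\<delta>\<close>, so their product
    divided by \<open>\<delta>\<close> has exactly these remainders as marginals.\<close>
  define f where "f = (\<lambda>(a, b). (if a = b then m a else 0) + (pmf p a - m a) * (pmf q b - m b) / \<delta>)"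
  have f0: "f z \<ge> 0" for z
    using m \<open>\<delta> > 0\<close> by (auto simp: f_def split: prod.split)
  have row: "(\<Sum>b\<in>UNIV. f (a, b)) = pmf p a" for a
    using \<open>\<delta> > 0\<close> by (simp add: f_def sum.distrib dq flip: sum_divide_distrib sum_distrib_left)
  have col: "(\<Sum>a\<in>UNIV. f (a, b)) = pmf q b" for b
    using \<open>\<delta> > 0\<close> by (simp add: f_def sum.distrib dp flip: sum_divide_distrib sum_distrib_right)
  have tot: "(\<Sum>z\<in>UNIV. f z) = 1"
  proof -
    have "(\<Sum>z\<in>UNIV. f z) = (\<Sum>a\<in>UNIV. \<Sum>b\<in>UNIV. f (a, b))"
      by (simp add: sum.cartesian_product)
    then show ?thesis by (simp add: row sp)
  qed
  define w where "w = embed_pmf f"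
  have w: "pmf w z = f z" for z
    unfolding w_def
    by (rule pmf_embed_pmf) (auto simp: f0 nn_integral_count_space_finite sum_ennreal tot)
  have "map_pmf fst w = p"
  proof (rule pmf_eqI)
    fix a
    have "pmf (map_pmf fst w) a = (\<Sum>z\<in>fst -` {a}. f z)"
      by (simp add: pmf_map measure_measure_pmf_finite w)
    also have "fst -` {a} = {a} \<times> (UNIV :: 'a set)" by auto
    finally show "pmf (map_pmf fst w) a = pmf p a" by (simp add: sum.cartesian_product' row)
  qed
  moreover have "map_pmf snd w = q"
  proof (rule pmf_eqI)
    fix b
    have "pmf (map_pmf snd w) b = (\<Sum>z\<in>snd -` {b}. f z)"
      by (simp add: pmf_map measure_measure_pmf_finite w)
    also have "snd -` {b} = (UNIV :: 'a set) \<times> {b}" by auto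
    finally show "pmf (map_pmf snd w) b = pmf q b" by (simp add: sum.cartesian_product' col)
  qed
  moreover have "measure_pmf.prob w {z. fst z \<noteq> snd z} \<le> (\<Sum>a\<in>UNIV. \<bar>pmf p a - pmf q a\<bar>)"
  proof -
    have "measure_pmf.prob w {z. fst z \<noteq> snd z} = (\<Sum>z\<in>{z. fst z \<noteq> snd z}. f z)"
      by (simp add: measure_measure_pmf_finite w)
    also have "\<dots> = (\<Sum>z\<in>{z. fst z \<noteq> snd z}. (pmf p (fst z) - m (fst z)) * (pmf q (snd z) - m (snd z)) / \<delta>)"
      by (intro sum.cong) (auto simp: f_def)
    also have "\<dots> \<le> (\<Sum>z\<in>UNIV. (pmf p (fst z) - m (fst z)) * (pmf q (snd z) - m (snd z)) / \<delta>)"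
      by (intro sum_mono2) (use m \<open>\<delta> > 0\<close> in auto)
    also have "\<dots> = \<delta>"
    proof -
      have "(\<Sum>z\<in>UNIV. (pmf p (fst z) - m (fst z)) * (pmf q (snd z) - m (snd z)) / \<delta>)
          = (\<Sum>a\<in>UNIV. \<Sum>b\<in>UNIV. (pmf p a - m a) * (pmf q b - m b) / \<delta>)"
        by (simp add: sum.cartesian_product case_prod_unfold)
      then show ?thesis using \<open>\<delta> > 0\<close>
        by (simp add: dp dq flip: sum_divide_distrib sum_distrib_left sum_distrib_right)
    qed
    also have "\<dots> \<le> (\<Sum>a\<in>UNIV. \<bar>pmf p a - pmf q a\<bar>)"
      unfolding dp[symmetric] by (intro sum_mono) (auto simp: m_def)
    finally show ?thesis .
  qed
  ultimately show ?thesis by blast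
qed

section \<open>Functions on the unit interval with finitely many discontinuities\<close>

text \<open>Weaker than being Lipschitz off a finite set, but stable under products without any
  boundedness condition; together with a bound it is all that dominated convergence needs.\<close>

definition continuous_except_finite :: "(real \<Rightarrow> real) \<Rightarrow> bool" where
  "continuous_except_finite f \<longleftrightarrow>
     (\<exists>D. finite D \<and> (\<forall>a\<in>{0..1} - D. continuous (at a within {0..1}) f))"

lemma continuous_except_finite_const: "continuous_except_finite (\<lambda>_. c)"
  unfolding continuous_except_finite_def by (auto intro!: exI[of _ "{}"])

lemma continuous_except_finite_mult:
  assumes "continuous_except_finite f" "continuous_except_finite g"
  shows "continuous_except_finite (\<lambda>a. f a * g a)"
proof -
  from assms obtain D D' where "finite D" "finite D'"
    "\<forall>a\<in>{0..1} - D. continuous (at a within {0..1}) f"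
    "\<forall>a\<in>{0..1} - D'. continuous (at a within {0..1}) g"
    unfolding continuous_except_finite_def by blast
  then show ?thesis unfolding continuous_except_finite_def
    by (intro exI[of _ "D \<union> D'"]) (auto intro!: continuous_mult)
qed

lemma continuous_except_finite_sum:
  assumes "finite I" "\<And>i. i \<in> I \<Longrightarrow> continuous_except_finite (f i)"
  shows "continuous_except_finite (\<lambda>a. \<Sum>i\<in>I. f i a)"
proof -
  from assms(2) obtain D where D: "\<And>i. i \<in> I \<Longrightarrow> finite (D i)"
    "\<And>i a. i \<in> I \<Longrightarrow> a \<in> {0..1} - D i \<Longrightarrow> continuous (at a within {0..1}) (f i)"
    unfolding continuous_except_finite_def by metis
  show ?thesis unfolding continuous_except_finite_def
    by (intro exI[of _ "\<Union>i\<in>I. D i"]) (auto intro!: continuous_sum D assms(1))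
qed

text \<open>Carries regularity through the kernel, which is Lipschitz only on nonnegative arguments,
  and from the flow to a mean field that agrees with it only on the unit interval.\<close>

lemma continuous_except_finite_modulus:
  assumes g: "finite I" "\<And>i. i \<in> I \<Longrightarrow> continuous_except_finite (g i)"
    and f: "\<And>a b. a \<in> {0..1} \<Longrightarrow> b \<in> {0..1} \<Longrightarrow> \<bar>f a - f b\<bar> \<le> L * (\<Sum>i\<in>I. \<bar>g i a - g i b\<bar>)"
  shows "continuous_except_finite f"
proof -
  from g(2) obtain D where D: "\<And>i. i \<in> I \<Longrightarrow> finite (D i)"
    "\<And>i a. i \<in> I \<Longrightarrow> a \<in> {0..1} - D i \<Longrightarrow> continuous (at a within {0..1}) (g i)"
    unfolding continuous_except_finite_def by metis
  have "continuous (at a within {0..1}) f" if a: "a \<in> {0..1} - (\<Union>i\<in>I. D i)" for a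
  proof -
    have "((\<lambda>b. L * (\<Sum>i\<in>I. \<bar>g i a - g i b\<bar>)) \<longlongrightarrow> L * (\<Sum>i\<in>I. \<bar>g i a - g i a\<bar>)) (at a within {0..1})"
      using D(2) a by (intro tendsto_intros) (auto simp: continuous_within)
    then have lim: "((\<lambda>b. L * (\<Sum>i\<in>I. \<bar>g i a - g i b\<bar>)) \<longlongrightarrow> 0) (at a within {0..1})"
      by simp
    have "\<forall>\<^sub>F b in at a within {0..1}. norm (f b - f a) \<le> L * (\<Sum>i\<in>I. \<bar>g i a - g i b\<bar>)"
      using f[of a] a by (auto simp: eventually_at_filter abs_minus_commute intro!: always_eventually)
    then have "((\<lambda>b. f b - f a) \<longlongrightarrow> 0) (at a within {0..1})"
      using lim by (rule Lim_null_comparison)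
    then show ?thesis by (simp add: continuous_within LIM_zero_iff)
  qed
  then show ?thesis unfolding continuous_except_finite_def
    using g(1) D(1) by (intro exI[of _ "\<Union>i\<in>I. D i"]) auto
qed

lemma lipschitz_except_finite_imp_continuous:
  assumes "lipschitz_except_finite f"
  shows "continuous_except_finite f"
proof -
  from assms obtain D L where D: "finite D" and L: "\<And>a b. a \<in> {0..1} \<Longrightarrow> b \<in> {0..1} \<Longrightarrow>
      {min a b..max a b} \<inter> D = {} \<Longrightarrow> \<bar>f a - f b\<bar> \<le> L * \<bar>a - b\<bar>"
    unfolding lipschitz_except_finite_def by blast
  have "continuous (at a within {0..1}) f" if a: "a \<in> {0..1} - D" for a
  proof -
    \<comment> \<open>A finite set is closed, so for \<open>b\<close> near \<open>a\<close> the
      segment between them avoids \<open>D\<close>.\<close>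
    from finite_imp_closed[OF D] a have "open (- D)" "a \<in> - D" by (auto simp: open_Compl)
    then obtain e where e: "e > 0" "ball a e \<subseteq> - D" by (auto simp: open_contains_ball)
    have "\<bar>f b - f a\<bar> \<le> L * \<bar>a - b\<bar>" if b: "b \<in> {0..1}" "\<bar>b - a\<bar> < e" for b
    proof -
      have "{min a b..max a b} \<subseteq> ball a e" using b e by (auto simp: dist_real_def)
      then have "{min a b..max a b} \<inter> D = {}" using e by blast
      from L[OF _ b(1) this] a show ?thesis by (simp add: abs_minus_commute)
    qed
    then have ev: "\<forall>\<^sub>F b in at a within {0..1}. norm (f b - f a) \<le> L * \<bar>a - b\<bar>"
      using e(1) by (auto simp: eventually_at dist_real_def)
    have "((\<lambda>b. L * \<bar>a - b\<bar>) \<longlongrightarrow> L * \<bar>a - a\<bar>) (at a within {0..1})"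
      by (intro tendsto_intros)
    then have "((\<lambda>b. L * \<bar>a - b\<bar>) \<longlongrightarrow> 0) (at a within {0..1})" by simp
    with ev have "((\<lambda>b. f b - f a) \<longlongrightarrow> 0) (at a within {0..1})"
      by (rule Lim_null_comparison)
    then show ?thesis by (simp add: continuous_within LIM_zero_iff)
  qed
  then show ?thesis unfolding continuous_except_finite_def using D by blast
qed

lemma continuous_except_finite_measurable:
  assumes "continuous_except_finite f"
  shows "set_borel_measurable lborel {0..1} f"
proof -
  from assms obtain D where D: "finite D"
    "\<And>a. a \<in> {0..1} - D \<Longrightarrow> continuous (at a within {0..1}) f"
    unfolding continuous_except_finite_def by blast
  \<comment> \<open>The endpoints join the exceptional set because the indicator factor may jump
    there.\<close>
  have "continuous_on (- (D \<union> {0, 1})) (\<lambda>x. indicat_real {0..1} x *\<^sub>R f x)"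
  proof (subst continuous_on_eq_continuous_at)
    show "open (- (D \<union> {0, 1}))" using D(1) by (intro open_Compl finite_imp_closed) auto
    show "\<forall>x\<in>- (D \<union> {0, 1}). isCont (\<lambda>x. indicat_real {0..1} x *\<^sub>R f x) x"
    proof
      fix x assume x: "x \<in> - (D \<union> {0, 1})"
      show "isCont (\<lambda>x. indicat_real {0..1} x *\<^sub>R f x) x"
      proof (cases "x \<in> {0<..<1}")
        case True
        then have "isCont f x"
          using D(2)[of x] x at_within_Icc_at[of 0 x 1] by auto
        moreover have "\<forall>\<^sub>F y in nhds x. y \<in> {0<..<1}"
          by (rule eventually_nhds_in_open) (use True in auto)
        then have "\<forall>\<^sub>F y in nhds x. f y = indicat_real {0..1} y *\<^sub>R f y"
          by eventually_elim auto
        ultimately show ?thesis by (subst isCont_cong[where g = f]) (auto elim: eventually_mono)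
      next
        case False
        with x have "x \<in> {..<0} \<union> {1<..}" by auto
        then have "\<forall>\<^sub>F y in nhds x. y \<in> {..<0} \<union> {1<..}"
          by (intro eventually_nhds_in_open) auto
        then have "\<forall>\<^sub>F y in nhds x. indicat_real {0..1} y *\<^sub>R f y = 0"
          by eventually_elim auto
        then show ?thesis by (subst isCont_cong[where g = "\<lambda>_. 0"]) (auto elim: eventually_mono)
      qed
    qed
  qed
  then have "(\<lambda>x. indicat_real {0..1} x *\<^sub>R f x) \<in> borel_measurable borel"
    by (rule borel_measurable_continuous_countable_exceptions[rotated])
       (use D(1) in \<open>auto intro!: countable_finite\<close>)
  then show ?thesis by (simp add: set_borel_measurable_def)
qed

section \<open>Integration over the unit interval and over grid cells\<close>

lemma set_integrable_unit_interval:
  fixes f :: "real \<Rightarrow> real"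
  assumes "set_borel_measurable lborel {0..1} f" "\<And>a. a \<in> {0..1} \<Longrightarrow> \<bar>f a\<bar> \<le> M"
  shows "set_integrable lborel {0..1} f"
  unfolding set_integrable_def
proof (rule Bochner_Integration.integrable_bound)
  show "integrable lborel (\<lambda>a::real. indicat_real {0..1} a *\<^sub>R M)"
    by (intro integrable_scaleR_left integrable_real_indicator) auto
  show "(\<lambda>a. indicat_real {0..1} a *\<^sub>R f a) \<in> borel_measurable lborel"
    using assms(1) by (simp add: set_borel_measurable_def)
  show "AE a in lborel. norm (indicat_real {0..1} a *\<^sub>R f a) \<le> norm (indicat_real {0..1} a *\<^sub>R M)"
  proof (rule AE_I2)
    fix a
    show "norm (indicat_real {0..1} a *\<^sub>R f a) \<le> norm (indicat_real {0..1} a *\<^sub>R M)"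
      using assms(2)[of a] by (cases "a \<in> {0..1}") auto
  qed
qed

text \<open>A function that is not integrable has integral 0 by convention, and \<open>M\<close> is
  nonnegative because it bounds an absolute value. Later bounds can thus be read off
  pointwise.\<close>

lemma set_lebesgue_integral_unit_interval_bound:
  fixes f :: "real \<Rightarrow> real"
  assumes "\<And>a. a \<in> {0..1} \<Longrightarrow> \<bar>f a\<bar> \<le> M"
  shows "\<bar>set_lebesgue_integral lborel {0..1} f\<bar> \<le> M"
proof (cases "set_integrable lborel {0..1} f")
  case True
  have "\<bar>set_lebesgue_integral lborel {0..1} f\<bar> \<le> set_lebesgue_integral lborel {0..1} (\<lambda>a. \<bar>f a\<bar>)"
    using set_integral_norm_bound[OF True] by simp
  also have "\<dots> \<le> set_lebesgue_integral lborel {0..1::real} (\<lambda>_. M)"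
    by (intro set_integral_mono set_integrable_abs True) (auto simp: assms set_integrable_def)
  also have "\<dots> = M" by (simp add: set_lebesgue_integral_def)
  finally show ?thesis .
next
  case False
  then have "set_lebesgue_integral lborel {0..1} f = 0"
    by (simp add: set_integrable_def set_lebesgue_integral_def not_integrable_integral_eq)
  with assms[of 0] show ?thesis by simp
qed

text \<open>The rounding used by \<open>step_graphon\<close>: for \<open>k \<ge> 1\<close> the value
  \<open>k\<close> is taken on the half-open interval from \<open>(k - 1) / N\<close> to
  \<open>k / N\<close>, and \<open>a = 0\<close> falls into cell 0, which belongs to no
  vertex.\<close>

definition cell :: "nat \<Rightarrow> real \<Rightarrow> nat" where
  "cell N a = nat \<lceil>real N * a\<rceil>"

lemma cell_le: "a \<in> {0..1} \<Longrightarrow> cell N a \<le> N"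
proof -
  assume "a \<in> {0..1}"
  then have "real N * a \<le> real N * 1" by (intro mult_left_mono) auto
  then show "cell N a \<le> N" by (simp add: cell_def nat_le_iff ceiling_le_iff)
qed

lemma cell_grid: "a \<in> {0..1} \<Longrightarrow> real (cell N a) / real N \<in> {0..1}"
  using cell_le[of a N] by (auto simp: divide_le_eq_1)

lemma measurable_cell [measurable]: "cell N \<in> measurable borel (count_space UNIV)"
  unfolding cell_def by measurable

lemma cell_grid_tendsto:
  assumes "a \<in> {0..1}"
  shows "(\<lambda>N. real (cell N a) / real N) \<longlonglongrightarrow> a"
proof (rule real_tendsto_sandwich)
  have bd: "real N * a \<le> real (cell N a)" "real (cell N a) \<le> real N * a + 1" for N
  proof -
    have "0 \<le> real N * a" using assms by simp
    then have "0 \<le> \<lceil>real N * a\<rceil>" by linarith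
    then have "real (cell N a) = of_int \<lceil>real N * a\<rceil>" by (simp add: cell_def)
    then show "real N * a \<le> real (cell N a)" "real (cell N a) \<le> real N * a + 1" by linarith+
  qed
  show "\<forall>\<^sub>F N in sequentially. a \<le> real (cell N a) / real N"
    using eventually_gt_at_top[of 0]
    by eventually_elim (use bd in \<open>simp add: le_divide_eq mult.commute\<close>)
  show "\<forall>\<^sub>F N in sequentially. real (cell N a) / real N \<le> a + 1 / real N"
    using eventually_gt_at_top[of 0]
  proof eventually_elim
    case (elim N)
    then have "(real N * a + 1) / real N = a + 1 / real N" by (simp add: field_simps)
    then show ?case using divide_right_mono[OF bd(2)[of N], of "real N"] by simp
  qed
  show "(\<lambda>N. a) \<longlonglongrightarrow> a" by simp
  have "(\<lambda>N. a + 1 / real N) \<longlonglongrightarrow> a + 0" by (intro tendsto_intros lim_1_over_n)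
  then show "(\<lambda>N. a + 1 / real N) \<longlonglongrightarrow> a" by simp
qed

text \<open>Dominated convergence: the right ends of the cells tend to \<open>a\<close>, so the
  integrand tends to 0 off a finite set, under the bound \<open>2 * M\<close>. This compares a
  function with its samples at the positions of the agents.\<close>

lemma cell_discretization_tendsto_0:
  assumes f: "continuous_except_finite f" and M: "\<And>a. a \<in> {0..1} \<Longrightarrow> \<bar>f a\<bar> \<le> M"
  shows "(\<lambda>N. set_lebesgue_integral lborel {0..1} (\<lambda>a. \<bar>f (real (cell N a) / real N) - f a\<bar>)) \<longlonglongrightarrow> 0"
proof -
  from f obtain D where D: "finite D"
    "\<And>a. a \<in> {0..1} - D \<Longrightarrow> continuous (at a within {0..1}) f"
    unfolding continuous_except_finite_def by blast
  have fm[measurable]: "(\<lambda>a. indicat_real {0..1} a *\<^sub>R f a) \<in> borel_measurable borel"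
    using continuous_except_finite_measurable[OF f] by (simp add: set_borel_measurable_def)
  let ?h = "\<lambda>N a. indicat_real {0..1} a *\<^sub>R \<bar>f (real (cell N a) / real N) - f a\<bar>"
  have "(\<lambda>N. LINT a|lborel. ?h N a) \<longlonglongrightarrow> (LINT a|(lborel :: real measure). 0 :: real)"
  proof (rule integral_dominated_convergence[where w = "\<lambda>a. indicat_real {0..1} a *\<^sub>R (2 * M)"])
    show "?h N \<in> borel_measurable lborel" for N
    proof -
      \<comment> \<open>The sampled function factors through \<open>cell\<close>, a measurable map
        into a discrete space, so its measurability does not depend on the sampled values.\<close>
      have "?h N = (\<lambda>a. \<bar>indicat_real {0..1} a * (\<lambda>k. f (real k / real N)) (cell N a)
              - indicat_real {0..1} a *\<^sub>R f a\<bar>)"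
        by (auto simp: fun_eq_iff indicator_def)
      also have "\<dots> \<in> borel_measurable lborel" by measurable
      finally show ?thesis .
    qed
    show "integrable lborel (\<lambda>a::real. indicat_real {0..1} a *\<^sub>R (2 * M))"
      by (intro integrable_scaleR_left integrable_real_indicator) auto
    show "AE a in lborel. (\<lambda>N. ?h N a) \<longlonglongrightarrow> 0"
    proof (rule AE_mp[OF AE_not_in[of D]])
      show "D \<in> null_sets lborel" using D(1) by (intro finite_imp_null_set_lborel)
      show "AE a in lborel. a \<notin> D \<longrightarrow> (\<lambda>N. ?h N a) \<longlonglongrightarrow> 0"
      proof (intro AE_I2 impI)
        fix a assume "a \<notin> D"
        show "(\<lambda>N. ?h N a) \<longlonglongrightarrow> 0"
        proof (cases "a \<in> {0..1}")
          case True
          have "(\<lambda>N. f (real (cell N a) / real N)) \<longlonglongrightarrow> f a"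
            by (rule continuous_within_tendsto_compose'[OF D(2)])
               (use True \<open>a \<notin> D\<close> cell_grid cell_grid_tendsto in auto)
          then have "(\<lambda>N. \<bar>f (real (cell N a) / real N) - f a\<bar>) \<longlonglongrightarrow> \<bar>f a - f a\<bar>"
            by (intro tendsto_intros)
          then show ?thesis using True by simp
        qed simp
      qed
    qed
    show "AE a in lborel. norm (?h N a) \<le> indicat_real {0..1} a *\<^sub>R (2 * M)" for N
    proof (intro AE_I2)
      fix a
      show "norm (?h N a) \<le> indicat_real {0..1} a *\<^sub>R (2 * M)"
      proof (cases "a \<in> {0..1}")
        case True
        with M[OF True] M[OF cell_grid[OF True, of N]] show ?thesis by simp
      qed simp
    qed
  qed simp
  then show ?thesis by (simp add: set_lebesgue_integral_def)
qed

text \<open>Turns averages over vertices into integrals; this is how the operator norm becomes a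
  statement about the graph.\<close>

lemma set_integral_cell:
  fixes f :: "nat \<Rightarrow> real"
  assumes N: "N > 0"
  shows "set_integrable lborel {0..1} (\<lambda>a. f (cell N a))" (is ?I)
    and "set_lebesgue_integral lborel {0..1} (\<lambda>a. f (cell N a)) = (\<Sum>k\<in>{1..N}. f k) / real N" (is ?S)
proof -
  let ?J = "\<lambda>k. {(real k - 1) / real N<..real k / real N}"
  let ?g = "\<lambda>a. \<Sum>k\<in>{1..N}. f k * indicat_real (?J k) a"
  have cell_iff: "a \<in> ?J k \<longleftrightarrow> cell N a = k" if "k \<ge> 1" for a k
  proof -
    have "a \<in> ?J k \<longleftrightarrow> real k - 1 < real N * a \<and> real N * a \<le> real k"
      using N by (simp add: divide_less_eq le_divide_eq mult.commute)
    also have "\<dots> \<longleftrightarrow> \<lceil>real N * a\<rceil> = int k"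
      by (simp add: ceiling_eq_iff)
    also have "\<dots> \<longleftrightarrow> cell N a = k" using that by (auto simp: cell_def)
    finally show ?thesis .
  qed
  \<comment> \<open>The identity fails to be automatic only at \<open>a = 0\<close>, whose cell has
    no vertex; this null set is excluded.\<close>
  have AE: "AE a in lborel. ?g a = indicat_real {0..1} a *\<^sub>R f (cell N a)"
  proof (rule AE_mp[OF AE_lborel_singleton[of 0]], intro AE_I2 impI)
    fix a :: real assume "a \<noteq> 0"
    have "?g a = (\<Sum>k\<in>{1..N}. if cell N a = k then f k else 0)"
      by (intro sum.cong refl) (simp add: indicator_def cell_iff del: greaterThanAtMost_iff)
    also have "\<dots> = (if cell N a \<in> {1..N} then f (cell N a) else 0)" by simp
    also have "cell N a \<in> {1..N} \<longleftrightarrow> a \<in> {0..1}"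
    proof
      assume *: "cell N a \<in> {1..N}"
      then have "a \<in> ?J (cell N a)" using cell_iff[of "cell N a" a] by simp
      moreover have "(real (cell N a) - 1) / real N \<ge> 0" using * by simp
      moreover have "real (cell N a) / real N \<le> 1" using * N by (simp add: divide_le_eq_1)
      ultimately show "a \<in> {0..1}" unfolding greaterThanAtMost_iff atLeastAtMost_iff by linarith
    next
      assume *: "a \<in> {0..1}"
      then have "real N * a > 0" using N \<open>a \<noteq> 0\<close> by simp
      then have "cell N a \<ge> 1" unfolding cell_def by linarith
      then show "cell N a \<in> {1..N}" using cell_le[OF *, of N] by auto
    qed
    finally show "?g a = indicat_real {0..1} a *\<^sub>R f (cell N a)" by simp
  qed
  have int: "integrable lborel ?g"
    using N by (intro Bochner_Integration.integrable_sum integrable_mult_right integrable_real_indicator)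
      (auto simp: divide_right_mono)
  have meas: "(\<lambda>a. indicat_real {0..1} a *\<^sub>R f (cell N a)) \<in> borel_measurable lborel"
    by measurable
  show ?I unfolding set_integrable_def
    by (rule integrable_cong_AE_imp[OF int meas]) (use AE in auto)
  have "set_lebesgue_integral lborel {0..1} (\<lambda>a. f (cell N a)) = integral\<^sup>L lborel ?g"
    unfolding set_lebesgue_integral_def
    by (rule integral_cong_AE[OF borel_measurable_integrable[OF int] meas AE, symmetric])
  also have "\<dots> = (\<Sum>k\<in>{1..N}. f k * (1 / real N))"
  proof (subst Bochner_Integration.integral_sum)
    show "(\<Sum>k\<in>{1..N}. LINT a|lborel. f k * indicat_real (?J k) a) = (\<Sum>k\<in>{1..N}. f k * (1 / real N))"
      using N by (intro sum.cong refl) (simp add: divide_right_mono flip: diff_divide_distrib)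
  qed (use N in \<open>auto intro!: integrable_mult_right integrable_real_indicator simp: divide_right_mono\<close>)
  finally show ?S by (simp add: sum_divide_distrib)
qed

section \<open>Graphs close to a graphon\<close>

text \<open>The regularity kept from the graphon concerns its first variable, with a constant
  uniform in the second; this is the form that passes to the integral operator. \<open>D\<close>
  collects the breakpoints.\<close>

locale regular_graphon =
  fixes W :: "real \<Rightarrow> real \<Rightarrow> real" and C L :: real and D :: "real set"
  assumes W_section_measurable: "a \<in> {0..1} \<Longrightarrow> set_borel_measurable lborel {0..1} (W a)"
    and W_nonneg: "a \<in> {0..1} \<Longrightarrow> b \<in> {0..1} \<Longrightarrow> 0 \<le> W a b"
    and W_le: "a \<in> {0..1} \<Longrightarrow> b \<in> {0..1} \<Longrightarrow> W a b \<le> C"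
    and C_pos: "C > 0" and L_nonneg: "L \<ge> 0"
    and finite_D: "finite D"
    and W_lipschitz: "a \<in> {0..1} \<Longrightarrow> a' \<in> {0..1} \<Longrightarrow> {min a a'..max a a'} \<inter> D = {} \<Longrightarrow>
      b \<in> {0..1} \<Longrightarrow> \<bar>W a b - W a' b\<bar> \<le> L * \<bar>a - a'\<bar>"

section \<open>Breakpoints and bounds of a piecewise Lipschitz graphon\<close>

lemma piecewise_lipschitz_section:
  assumes "graphon_piecewise_lipschitz W"
  shows "\<exists>D L. finite D \<and> L \<ge> 0 \<and> (\<forall>a\<in>{0..1}. \<forall>a'\<in>{0..1}. {min a a'..max a a'} \<inter> D = {} \<longrightarrow>
    (\<forall>b\<in>{0..1}. \<bar>W a b - W a' b\<bar> \<le> L * \<bar>a - a'\<bar>))"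
  using assms unfolding graphon_piecewise_lipschitz_def
proof (elim disjE exE conjE)
  fix L assume L: "\<forall>x\<in>{0..1}. \<forall>y\<in>{0..1}. \<forall>x'\<in>{0..1}. \<forall>y'\<in>{0..1}.
         \<bar>W x y - W x' y'\<bar> \<le> L * (\<bar>x - x'\<bar> + \<bar>y - y'\<bar>)"
  have "\<bar>W a b - W a' b\<bar> \<le> \<bar>L\<bar> * \<bar>a - a'\<bar>"
    if "a \<in> {0..1}" "a' \<in> {0..1}" "b \<in> {0..1}" for a a' b
  proof -
    have "\<bar>W a b - W a' b\<bar> \<le> L * (\<bar>a - a'\<bar> + \<bar>b - b\<bar>)" using L that by blast
    also have "\<dots> \<le> \<bar>L\<bar> * \<bar>a - a'\<bar>" by (simp add: mult_right_mono)
    finally show ?thesis .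
  qed
  then show ?thesis by (intro exI[of _ "{}"] exI[of _ "\<bar>L\<bar>"]) auto
next
  fix L :: real and Q :: nat and Iv :: "nat \<Rightarrow> real set"
  assume L0: "L > 0" and Iv: "\<forall>i<Q. is_interval (Iv i)"
    and cover: "(\<Union>i<Q. Iv i) = {0..1}"
    and L: "\<forall>i<Q. \<forall>j<Q. \<forall>x\<in>Iv i. \<forall>x'\<in>Iv i. \<forall>y\<in>Iv j. \<forall>y'\<in>Iv j.
            \<bar>W x y - W x' y'\<bar> \<le> L * (\<bar>x - x'\<bar> + \<bar>y - y'\<bar>)"
  \<comment> \<open>An interval is left towards the right only by passing its supremum, whether or
    not the supremum belongs to it. Two points whose closed segment avoids all these suprema
    therefore lie in one interval.\<close>
  let ?D = "(\<lambda>i. Sup (Iv i)) ` {..<Q}"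
  have same: "a' \<in> Iv i" if "i < Q" "a \<in> Iv i" "a' \<in> {0..1}" "a \<le> a'" "{a..a'} \<inter> ?D = {}" for i a a'
  proof (rule ccontr)
    assume "a' \<notin> Iv i"
    have "y \<le> a'" if "y \<in> Iv i" for y
      using Iv \<open>i < Q\<close> \<open>a \<in> Iv i\<close> \<open>a \<le> a'\<close> \<open>a' \<notin> Iv i\<close> that
      unfolding is_interval_1 by (meson linear)
    then have "Sup (Iv i) \<le> a'" and "a \<le> Sup (Iv i)"
      using \<open>a \<in> Iv i\<close> by (auto intro!: cSup_least cSup_upper bdd_aboveI)
    then show False using that by auto
  qed
  have "\<bar>W a b - W a' b\<bar> \<le> L * \<bar>a - a'\<bar>"
    if a: "a \<in> {0..1}" "a' \<in> {0..1}" "b \<in> {0..1}" and D: "{min a a'..max a a'} \<inter> ?D = {}" for a a' b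
  proof -
    have "min a a' \<in> (\<Union>i<Q. Iv i)" unfolding cover using a by (auto simp: min_def)
    then obtain i where i: "i < Q" "min a a' \<in> Iv i" by blast
    then have "max a a' \<in> Iv i" using same[OF i, of "max a a'"] a D by auto
    with i have "a \<in> Iv i" "a' \<in> Iv i" by (auto simp: min_def max_def split: if_splits)
    moreover obtain j where "j < Q" "b \<in> Iv j" using a(3) cover by blast
    ultimately have "\<bar>W a b - W a' b\<bar> \<le> L * (\<bar>a - a'\<bar> + \<bar>b - b\<bar>)" using L i by blast
    then show ?thesis by simp
  qed
  then show ?thesis using L0 by (intro exI[of _ ?D] exI[of _ L]) auto
qed

lemma piecewise_lipschitz_bounded:
  assumes "graphon_piecewise_lipschitz W"
  shows "\<exists>C>0. \<forall>a\<in>{0..1}. \<forall>b\<in>{0..1}. W a b \<le> C"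
  using assms unfolding graphon_piecewise_lipschitz_def
proof (elim disjE exE conjE)
  fix L assume L: "\<forall>x\<in>{0..1}. \<forall>y\<in>{0..1}. \<forall>x'\<in>{0..1}. \<forall>y'\<in>{0..1}.
         \<bar>W x y - W x' y'\<bar> \<le> L * (\<bar>x - x'\<bar> + \<bar>y - y'\<bar>)"
  have "W a b \<le> \<bar>W 0 0\<bar> + 2 * \<bar>L\<bar> + 1" if "a \<in> {0..1}" "b \<in> {0..1}" for a b
  proof -
    have "\<bar>W a b - W 0 0\<bar> \<le> L * (\<bar>a - 0\<bar> + \<bar>b - 0\<bar>)" using L that by fastforce
    also have "\<dots> \<le> \<bar>L\<bar> * (\<bar>a - 0\<bar> + \<bar>b - 0\<bar>)" by (intro mult_right_mono) auto
    also have "\<dots> \<le> \<bar>L\<bar> * 2" using that by (intro mult_left_mono) auto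
    finally show ?thesis by linarith
  qed
  then show ?thesis by (intro exI[of _ "\<bar>W 0 0\<bar> + 2 * \<bar>L\<bar> + 1"]) auto
next
  fix L :: real and Q :: nat and Iv :: "nat \<Rightarrow> real set"
  assume L0: "L > 0" and cover: "(\<Union>i<Q. Iv i) = {0..1}"
    and L: "\<forall>i<Q. \<forall>j<Q. \<forall>x\<in>Iv i. \<forall>x'\<in>Iv i. \<forall>y\<in>Iv j. \<forall>y'\<in>Iv j.
            \<bar>W x y - W x' y'\<bar> \<le> L * (\<bar>x - x'\<bar> + \<bar>y - y'\<bar>)"
  \<comment> \<open>One representative per interval: on each rectangle \<open>W\<close> differs from
    its value at the representatives by at most \<open>2 * L\<close>, and there are finitely many
    rectangles. An empty interval receives an arbitrary point, which can only enlarge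
    \<open>S\<close>.\<close>
  define z where "z i = (SOME x. x \<in> Iv i)" for i
  define S where "S = (\<Sum>i<Q. \<Sum>j<Q. \<bar>W (z i) (z j)\<bar>)"
  have S0: "S \<ge> 0" unfolding S_def by (intro sum_nonneg) auto
  have "W a b \<le> S + 2 * L" if ab: "a \<in> {0..1}" "b \<in> {0..1}" for a b
  proof -
    obtain i j where ij: "i < Q" "j < Q" "a \<in> Iv i" "b \<in> Iv j" using ab cover by blast
    then have z: "z i \<in> Iv i" "z j \<in> Iv j" unfolding z_def by (metis someI)+
    then have z01: "z i \<in> {0..1}" "z j \<in> {0..1}" using ij cover by blast+
    have "\<bar>W a b - W (z i) (z j)\<bar> \<le> L * (\<bar>a - z i\<bar> + \<bar>b - z j\<bar>)" using L ij z by blast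
    also have "\<dots> \<le> L * 2" using L0 ab z01 by (intro mult_left_mono) auto
    finally have "W a b \<le> \<bar>W (z i) (z j)\<bar> + 2 * L" by linarith
    also have "\<bar>W (z i) (z j)\<bar> \<le> (\<Sum>j<Q. \<bar>W (z i) (z j)\<bar>)"
      using ij by (intro member_le_sum) auto
    also have "\<dots> \<le> S" unfolding S_def
      using ij by (intro member_le_sum[of i _ "\<lambda>i. \<Sum>j<Q. \<bar>W (z i) (z j)\<bar>"] sum_nonneg) auto
    finally show ?thesis by simp
  qed
  then show ?thesis using L0 S0 by (intro exI[of _ "S + 2 * L"]) auto
qed

lemma is_graphon_imp_regular:
  assumes "is_graphon W" "graphon_piecewise_lipschitz W"
  shows "\<exists>C L D. regular_graphon W C L D"
proof -
  from piecewise_lipschitz_bounded[OF assms(2)] obtain C where C: "C > 0"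
    "\<forall>a\<in>{0..1}. \<forall>b\<in>{0..1}. W a b \<le> C" by blast
  from piecewise_lipschitz_section[OF assms(2)] obtain D L where DL: "finite D" "L \<ge> 0"
    "\<forall>a\<in>{0..1}. \<forall>a'\<in>{0..1}. {min a a'..max a a'} \<inter> D = {} \<longrightarrow>
    (\<forall>b\<in>{0..1}. \<bar>W a b - W a' b\<bar> \<le> L * \<bar>a - a'\<bar>)" by blast
  have "set_borel_measurable lborel {0..1} (W a)" if a: "a \<in> {0..1}" for a
  proof -
    have m: "(\<lambda>z. indicat_real ({0..1} \<times> {0..1}) z *\<^sub>R (\<lambda>(x, y). W x y) z)
        \<in> borel_measurable (lborel \<Otimes>\<^sub>M lborel)"
      using assms(1) by (simp add: is_graphon_def set_borel_measurable_def)
    have "(\<lambda>b. (a, b)) \<in> measurable lborel (lborel \<Otimes>\<^sub>M lborel)" by measurable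
    from measurable_compose[OF this m] a show ?thesis
      by (simp add: set_borel_measurable_def indicator_times)
  qed
  then have "regular_graphon W C L D"
    using assms(1) C DL unfolding is_graphon_def by unfold_locales auto
  then show ?thesis by blast
qed

section \<open>The integral operator of the graphon\<close>

context regular_graphon
begin

definition wint :: "(real \<Rightarrow> real) \<Rightarrow> real \<Rightarrow> real" where
  "wint g a = set_lebesgue_integral lborel {0..1} (\<lambda>b. W a b * g b)"

lemma graphon_agg_eq_wint: "graphon_agg W m a x = wint (\<lambda>b. m b x) a"
  by (simp add: graphon_agg_def wint_def)

lemma W_abs_le: "a \<in> {0..1} \<Longrightarrow> b \<in> {0..1} \<Longrightarrow> \<bar>W a b\<bar> \<le> C"
  using W_nonneg[of a b] W_le[of a b] by auto

lemma wint_integrable: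
  assumes "set_borel_measurable lborel {0..1} g" "\<And>b. b \<in> {0..1} \<Longrightarrow> \<bar>g b\<bar> \<le> K" "a \<in> {0..1}"
  shows "set_integrable lborel {0..1} (\<lambda>b. W a b * g b)"
proof (rule set_integrable_unit_interval)
  have "(\<lambda>b. (indicat_real {0..1} b *\<^sub>R W a b) * (indicat_real {0..1} b *\<^sub>R g b)) \<in> borel_measurable lborel"
    using assms(1) W_section_measurable[OF assms(3)]
    unfolding set_borel_measurable_def by (rule borel_measurable_times[rotated])
  also have "(\<lambda>b. (indicat_real {0..1} b *\<^sub>R W a b) * (indicat_real {0..1} b *\<^sub>R g b))
    = (\<lambda>b. indicat_real {0..1} b *\<^sub>R (W a b * g b))"
    by (auto simp: indicator_def fun_eq_iff)
  finally show "set_borel_measurable lborel {0..1} (\<lambda>b. W a b * g b)"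
    by (simp add: set_borel_measurable_def)
  show "\<bar>W a b * g b\<bar> \<le> C * K" if "b \<in> {0..1}" for b
    unfolding abs_mult using W_abs_le[OF assms(3) that] assms(2)[OF that]
    by (intro mult_mono) (use C_pos in auto)
qed

lemma wint_abs_le:
  assumes "\<And>b. b \<in> {0..1} \<Longrightarrow> \<bar>g b\<bar> \<le> K" "a \<in> {0..1}"
  shows "\<bar>wint g a\<bar> \<le> C * K"
  unfolding wint_def
proof (rule set_lebesgue_integral_unit_interval_bound)
  show "\<bar>W a b * g b\<bar> \<le> C * K" if "b \<in> {0..1}" for b
    unfolding abs_mult using W_abs_le[OF assms(2) that] assms(1)[OF that]
    by (intro mult_mono) (use C_pos in auto)
qed

lemma wint_nonneg:
  assumes "\<And>b. b \<in> {0..1} \<Longrightarrow> 0 \<le> g b" "a \<in> {0..1}"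
  shows "0 \<le> wint g a"
  unfolding wint_def set_lebesgue_integral_def
  using assms W_nonneg by (intro Bochner_Integration.integral_nonneg) (simp add: indicator_def)

text \<open>Since the kernel is bounded by \<open>C\<close>, a small L1 change of the argument
  changes the aggregate uniformly little.\<close>

lemma wint_abs_le_integral:
  assumes g: "set_borel_measurable lborel {0..1} g" "\<And>b. b \<in> {0..1} \<Longrightarrow> \<bar>g b\<bar> \<le> K" and a: "a \<in> {0..1}"
  shows "\<bar>wint g a\<bar> \<le> C * set_lebesgue_integral lborel {0..1} (\<lambda>b. \<bar>g b\<bar>)"
proof -
  have "\<bar>wint g a\<bar> \<le> set_lebesgue_integral lborel {0..1} (\<lambda>b. \<bar>W a b * g b\<bar>)"
    using set_integral_norm_bound[OF wint_integrable[OF g a]] by (simp add: wint_def)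
  also have "\<dots> \<le> set_lebesgue_integral lborel {0..1} (\<lambda>b. C * \<bar>g b\<bar>)"
  proof (rule set_integral_mono)
    show "set_integrable lborel {0..1} (\<lambda>b. C * \<bar>g b\<bar>)"
      using set_integrable_abs[OF set_integrable_unit_interval[OF g]] by simp
    show "\<bar>W a b * g b\<bar> \<le> C * \<bar>g b\<bar>" if "b \<in> {0..1}" for b
      unfolding abs_mult using W_abs_le[OF a that] by (intro mult_right_mono) auto
  qed (rule set_integrable_abs[OF wint_integrable[OF g a]])
  finally show ?thesis by simp
qed

lemma wint_diff:
  assumes "set_borel_measurable lborel {0..1} g" "\<And>b. b \<in> {0..1} \<Longrightarrow> \<bar>g b\<bar> \<le> K"
    and "set_borel_measurable lborel {0..1} h" "\<And>b. b \<in> {0..1} \<Longrightarrow> \<bar>h b\<bar> \<le> K'" and a: "a \<in> {0..1}"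
  shows "wint (\<lambda>b. g b - h b) a = wint g a - wint h a"
  using set_integral_diff(2)[OF wint_integrable[OF assms(1,2) a] wint_integrable[OF assms(3,4) a]]
  by (simp add: wint_def right_diff_distrib)

text \<open>The operator smooths: \<open>g\<close> is merely bounded and measurable, and the
  regularity comes from the first variable of \<open>W\<close>.\<close>

lemma continuous_except_finite_wint:
  assumes g: "set_borel_measurable lborel {0..1} g" "\<And>b. b \<in> {0..1} \<Longrightarrow> \<bar>g b\<bar> \<le> K"
  shows "continuous_except_finite (wint g)"
proof (rule lipschitz_except_finite_imp_continuous)
  \<comment> \<open>\<open>lipschitz_except_finite\<close> asks for exceptional points inside the
    unit interval; a segment between two points of that interval meets no other breakpoints.\<close>
  have "\<bar>wint g a - wint g a'\<bar> \<le> (L * K) * \<bar>a - a'\<bar>"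
    if a: "a \<in> {0..1}" "a' \<in> {0..1}" "{min a a'..max a a'} \<inter> (D \<inter> {0..1}) = {}" for a a'
  proof -
    have "{min a a'..max a a'} \<subseteq> {0..1}" using a(1,2) by (auto simp: min_def max_def)
    with a(3) have D: "{min a a'..max a a'} \<inter> D = {}" by blast
    have "wint g a - wint g a' = set_lebesgue_integral lborel {0..1} (\<lambda>b. W a b * g b - W a' b * g b)"
      unfolding wint_def
      by (rule set_integral_diff(2)[OF wint_integrable[OF g a(1)] wint_integrable[OF g a(2)], symmetric])
    also have "\<bar>\<dots>\<bar> \<le> (L * \<bar>a - a'\<bar>) * K"
    proof (rule set_lebesgue_integral_unit_interval_bound)
      fix b :: real assume b: "b \<in> {0..1}"
      have "\<bar>W a b * g b - W a' b * g b\<bar> = \<bar>W a b - W a' b\<bar> * \<bar>g b\<bar>"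
        by (simp add: abs_mult flip: left_diff_distrib)
      also have "\<dots> \<le> (L * \<bar>a - a'\<bar>) * K"
        using W_lipschitz[OF a(1,2) D b] g(2)[OF b] L_nonneg by (intro mult_mono) auto
      finally show "\<bar>W a b * g b - W a' b * g b\<bar> \<le> (L * \<bar>a - a'\<bar>) * K" .
    qed
    finally show ?thesis by (simp add: mult_ac)
  qed
  then show "lipschitz_except_finite (wint g)"
    unfolding lipschitz_except_finite_def
    by (intro exI[of _ "D \<inter> {0..1}"] exI[of _ "L * K"]) (use finite_D in auto)
qed

end

section \<open>Graph aggregates against graphon aggregates\<close>

locale graph_near_graphon = regular_graphon W C L D
  for W C L D +
  fixes E :: "nat \<Rightarrow> nat \<Rightarrow> bool" and N :: nat and rhoN :: real
  assumes N_pos: "N > 0" and rho_pos: "rhoN > 0" and E_sym: "E i j \<Longrightarrow> E j i"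
begin

definition \<delta> :: real where
  "\<delta> = linf_l1_norm (\<lambda>x y. step_graphon E N x y / rhoN - W x y)"

definition A :: "nat \<Rightarrow> nat \<Rightarrow> real" where
  "A k j = (if E k j then 1 / (real N * rhoN) else 0)"

definition \<theta> :: real where "\<theta> = 1 / (real N * rhoN)"

lemma \<theta>_pos: "\<theta> > 0" using N_pos rho_pos by (simp add: \<theta>_def)

lemma A_nonneg: "0 \<le> A k j" and A_le: "A k j \<le> \<theta>" and A_sym: "A k j = A j k"
  using N_pos rho_pos E_sym by (auto simp: A_def \<theta>_def)

lemma measurable_cell_fun: "set_borel_measurable lborel {0..1} (\<lambda>a. (f :: nat \<Rightarrow> real) (cell N a))"
  unfolding set_borel_measurable_def by measurable

text \<open>A configuration \<open>s\<close> is tested through the step function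
  \<open>s (cell N b)\<close>, whose integral against the rescaled step graphon is exactly the graph
  aggregate. The estimate is uniform in \<open>s\<close>, so it may be averaged over random
  configurations.\<close>

lemma graph_agg_close:
  assumes s: "\<And>j. \<bar>s j\<bar> \<le> 1"
  shows "set_lebesgue_integral lborel {0..1}
    (\<lambda>a. \<bar>(\<Sum>j\<in>{1..N}. A (cell N a) j * s j) - wint (\<lambda>b. s (cell N b)) a\<bar>) \<le> \<delta>"
proof -
  let ?U = "\<lambda>x y. step_graphon E N x y / rhoN - W x y"
  let ?G = "{g. g \<in> borel_measurable lborel \<and> (\<forall>b::real. \<bar>g b\<bar> \<le> (1::real))}"
  let ?F = "\<lambda>g. set_lebesgue_integral lborel {0..1}
        (\<lambda>a. \<bar>set_lebesgue_integral lborel {0..1} (\<lambda>b. ?U a b * g b)\<bar>)"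
  let ?g = "\<lambda>b. s (cell N b)"
  \<comment> \<open>A crude bound depending on \<open>rhoN\<close>; it makes the supremum in the
    norm an upper bound of its members.\<close>
  have "bdd_above (?F ` ?G)"
  proof (rule bdd_aboveI2)
    fix g assume g: "g \<in> ?G"
    have "\<bar>?F g\<bar> \<le> 1 / rhoN + C"
    proof (rule set_lebesgue_integral_unit_interval_bound, unfold abs_abs,
           rule set_lebesgue_integral_unit_interval_bound)
      fix a b :: real assume ab: "a \<in> {0..1}" "b \<in> {0..1}"
      have "\<bar>step_graphon E N a b / rhoN\<bar> \<le> 1 / rhoN"
        using rho_pos by (simp add: step_graphon_def)
      with W_abs_le[OF ab] have "\<bar>?U a b\<bar> \<le> 1 / rhoN + C" by linarith
      then have "\<bar>?U a b\<bar> * \<bar>g b\<bar> \<le> (1 / rhoN + C) * 1"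
        using g rho_pos C_pos by (intro mult_mono) auto
      then show "\<bar>?U a b * g b\<bar> \<le> 1 / rhoN + C" by (simp add: abs_mult)
    qed
    then show "?F g \<le> 1 / rhoN + C" by simp
  qed
  moreover have "?g \<in> ?G" using s by simp
  ultimately have "?F ?g \<le> \<delta>"
    unfolding \<delta>_def linf_l1_norm_def by (intro cSUP_upper)
  moreover have "?F ?g = set_lebesgue_integral lborel {0..1}
    (\<lambda>a. \<bar>(\<Sum>j\<in>{1..N}. A (cell N a) j * s j) - wint ?g a\<bar>)"
  proof (rule set_lebesgue_integral_cong)
    show "\<forall>a. a \<in> {0..1} \<longrightarrow> \<bar>set_lebesgue_integral lborel {0..1} (\<lambda>b. ?U a b * ?g b)\<bar>
        = \<bar>(\<Sum>j\<in>{1..N}. A (cell N a) j * s j) - wint ?g a\<bar>"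
    proof (intro allI impI)
      fix a :: real assume a: "a \<in> {0..1}"
      let ?f = "\<lambda>j. (if E (cell N a) j then 1 else 0) / rhoN * s j"
      have "(\<lambda>b. ?U a b * ?g b) = (\<lambda>b. ?f (cell N b) - W a b * ?g b)"
        by (auto simp: step_graphon_def cell_def left_diff_distrib)
      then have "set_lebesgue_integral lborel {0..1} (\<lambda>b. ?U a b * ?g b)
         = set_lebesgue_integral lborel {0..1} (\<lambda>b. ?f (cell N b)) - wint ?g a"
        unfolding wint_def
        using set_integral_diff(2)[OF set_integral_cell(1)[OF N_pos, of ?f]
            wint_integrable[OF measurable_cell_fun s a]] by simp
      also have "set_lebesgue_integral lborel {0..1} (\<lambda>b. ?f (cell N b)) = (\<Sum>j\<in>{1..N}. ?f j) / real N"
        by (rule set_integral_cell(2)[OF N_pos])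
      also have "\<dots> = (\<Sum>j\<in>{1..N}. A (cell N a) j * s j)"
        by (auto simp: sum_divide_distrib A_def intro!: sum.cong)
      finally show "\<bar>set_lebesgue_integral lborel {0..1} (\<lambda>b. ?U a b * ?g b)\<bar>
        = \<bar>(\<Sum>j\<in>{1..N}. A (cell N a) j * s j) - wint ?g a\<bar>" by simp
    qed
  qed simp
  ultimately show ?thesis by simp
qed

lemma wint_cell_integrable:
  assumes s: "\<And>j. \<bar>s j\<bar> \<le> K"
  shows "set_integrable lborel {0..1} (wint (\<lambda>b. s (cell N b)))"
  by (rule set_integrable_unit_interval[OF continuous_except_finite_measurable wint_abs_le])
     (auto intro: continuous_except_finite_wint[OF measurable_cell_fun] s)

text \<open>The reference \<open>c\<close> is left free: it will be 0 for random signs and the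
  graphon aggregate at the grid points for the mean field.\<close>

lemma average_graph_agg_close:
  assumes s: "\<And>j. \<bar>s j\<bar> \<le> 1"
  shows "(\<Sum>k\<in>{1..N}. \<bar>(\<Sum>j\<in>{1..N}. A k j * s j) - c k\<bar>) / real N
    \<le> \<delta> + set_lebesgue_integral lborel {0..1} (\<lambda>a. \<bar>wint (\<lambda>b. s (cell N b)) a - c (cell N a)\<bar>)"
proof -
  let ?S = "\<lambda>k. (\<Sum>j\<in>{1..N}. A k j * s j)" and ?w = "wint (\<lambda>b. s (cell N b))"
  note int = set_integral_cell(1)[OF N_pos] wint_cell_integrable[OF s]
  have i1: "set_integrable lborel {0..1} (\<lambda>a. \<bar>?S (cell N a) - ?w a\<bar>)"
    and i2: "set_integrable lborel {0..1} (\<lambda>a. \<bar>?w a - c (cell N a)\<bar>)"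
    by (intro set_integrable_abs set_integral_diff int int(1)[of ?S])+
  have "(\<Sum>k\<in>{1..N}. \<bar>?S k - c k\<bar>) / real N = set_lebesgue_integral lborel {0..1} (\<lambda>a. \<bar>?S (cell N a) - c (cell N a)\<bar>)"
    by (rule set_integral_cell(2)[OF N_pos, symmetric])
  also have "\<dots> \<le> set_lebesgue_integral lborel {0..1} (\<lambda>a. \<bar>?S (cell N a) - ?w a\<bar> + \<bar>?w a - c (cell N a)\<bar>)"
    by (rule set_integral_mono[OF int(1)[of "\<lambda>k. \<bar>?S k - c k\<bar>"] set_integral_add(1)[OF i1 i2]]) auto
  also have "\<dots> = set_lebesgue_integral lborel {0..1} (\<lambda>a. \<bar>?S (cell N a) - ?w a\<bar>)
      + set_lebesgue_integral lborel {0..1} (\<lambda>a. \<bar>?w a - c (cell N a)\<bar>)"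
    by (rule set_integral_add(2)[OF i1 i2])
  also have "\<dots> \<le> \<delta> + set_lebesgue_integral lborel {0..1} (\<lambda>a. \<bar>?w a - c (cell N a)\<bar>)"
    using graph_agg_close[OF s] by simp
  finally show ?thesis .
qed

definition deg :: "nat \<Rightarrow> real" where "deg k = (\<Sum>j\<in>{1..N}. A k j)"

text \<open>Test with the constant 1: the graphon degree is at most \<open>C\<close>, so whatever a
  vertex has beyond \<open>C\<close> counts as discrepancy.\<close>

lemma average_excess_degree_le: "(\<Sum>k\<in>{1..N}. max 0 (deg k - C)) / real N \<le> \<delta>"
proof -
  have "(\<Sum>k\<in>{1..N}. max 0 (deg k - C)) / real N
      = set_lebesgue_integral lborel {0..1} (\<lambda>a. max 0 (deg (cell N a) - C))"
    by (rule set_integral_cell(2)[OF N_pos, symmetric])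
  also have "\<dots> \<le> set_lebesgue_integral lborel {0..1}
      (\<lambda>a. \<bar>(\<Sum>j\<in>{1..N}. A (cell N a) j * 1) - wint (\<lambda>b. (\<lambda>_. 1) (cell N b)) a\<bar>)"
  proof (rule set_integral_mono)
    show "set_integrable lborel {0..1} (\<lambda>a. max 0 (deg (cell N a) - C))"
      by (rule set_integral_cell(1)[OF N_pos])
    show "set_integrable lborel {0..1}
      (\<lambda>a. \<bar>(\<Sum>j\<in>{1..N}. A (cell N a) j * 1) - wint (\<lambda>b. (\<lambda>_. 1) (cell N b)) a\<bar>)"
      by (intro set_integrable_abs set_integral_diff wint_cell_integrable[where K = 1]
          set_integral_cell(1)[OF N_pos, of "\<lambda>k. \<Sum>j\<in>{1..N}. A k j * 1"]) auto
    fix a :: real assume a: "a \<in> {0..1}"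
    have "wint (\<lambda>b. (\<lambda>_. 1) (cell N b)) a \<le> C"
      using wint_abs_le[of "\<lambda>_. 1" 1 a] a by simp
    then show "max 0 (deg (cell N a) - C)
      \<le> \<bar>(\<Sum>j\<in>{1..N}. A (cell N a) j * 1) - wint (\<lambda>b. (\<lambda>_. 1) (cell N b)) a\<bar>"
      by (simp add: deg_def)
  qed
  also have "\<dots> \<le> \<delta>" by (rule graph_agg_close) simp
  finally show ?thesis .
qed

lemma \<delta>_nonneg: "\<delta> \<ge> 0"
  using average_excess_degree_le by (rule order_trans[rotated]) (auto intro!: divide_nonneg_nonneg sum_nonneg)

text \<open>Two discretizations separate the vertices from the continuum: the mean field is sampled
  inside the operator, at the cost of \<open>C\<close> times an L1 error, and the limiting aggregate
  is read at \<open>k / N\<close> instead of throughout the cell.\<close>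

lemma average_mean_field_agg_close:
  assumes m: "continuous_except_finite m" "\<And>a. a \<in> {0..1} \<Longrightarrow> \<bar>m a\<bar> \<le> 1"
  shows "(\<Sum>k\<in>{1..N}. \<bar>(\<Sum>j\<in>{1..N}. A k j * m (real j / real N)) - wint m (real k / real N)\<bar>) / real N
    \<le> \<delta> + C * set_lebesgue_integral lborel {0..1} (\<lambda>a. \<bar>m (real (cell N a) / real N) - m a\<bar>)
        + set_lebesgue_integral lborel {0..1} (\<lambda>a. \<bar>wint m (real (cell N a) / real N) - wint m a\<bar>)"
proof -
  \<comment> \<open>Cut off beyond \<open>N\<close>, because \<open>m\<close> is bounded only on the
    unit interval whereas a test configuration must be bounded at every index.\<close>
  define s where "s j = (if j \<le> N then m (real j / real N) else 0)" for j
  have s1: "\<bar>s j\<bar> \<le> 1" for j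
    using m(2)[of "real j / real N"] N_pos by (auto simp: s_def divide_le_eq_1)
  have s_cell: "s (cell N a) = m (real (cell N a) / real N)" if "a \<in> {0..1}" for a
    using cell_le[OF that, of N] by (simp add: s_def)
  note mm = continuous_except_finite_measurable[OF m(1)]
  let ?ws = "wint (\<lambda>b. s (cell N b))"
  let ?I = "set_lebesgue_integral lborel {0..1} (\<lambda>a. \<bar>m (real (cell N a) / real N) - m a\<bar>)"
  let ?c = "\<lambda>k. wint m (real k / real N)"
  have w_int: "set_integrable lborel {0..1} (wint m)"
    by (rule set_integrable_unit_interval[OF continuous_except_finite_measurable wint_abs_le[OF m(2)]])
       (auto intro: continuous_except_finite_wint[OF mm m(2)])
  have diff: "\<bar>?ws a - wint m a\<bar> \<le> C * ?I" if a: "a \<in> {0..1}" for a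
  proof -
    have meas: "set_borel_measurable lborel {0..1} (\<lambda>b. s (cell N b) - m b)"
      using measurable_cell_fun[of s] mm unfolding set_borel_measurable_def
      by (simp add: right_diff_distrib)
    have bnd: "\<bar>s (cell N b) - m b\<bar> \<le> 2" if "b \<in> {0..1}" for b
      using s1[of "cell N b"] m(2)[OF that] by linarith
    have "\<bar>?ws a - wint m a\<bar> = \<bar>wint (\<lambda>b. s (cell N b) - m b) a\<bar>"
      by (subst wint_diff[OF measurable_cell_fun s1 mm m(2) a]) auto
    also have "\<dots> \<le> C * set_lebesgue_integral lborel {0..1} (\<lambda>b. \<bar>s (cell N b) - m b\<bar>)"
      by (rule wint_abs_le_integral[OF meas bnd a])
    also have "set_lebesgue_integral lborel {0..1} (\<lambda>b. \<bar>s (cell N b) - m b\<bar>) = ?I"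
      by (rule set_lebesgue_integral_cong) (auto simp: s_cell)
    finally show ?thesis .
  qed
  have "(\<Sum>k\<in>{1..N}. \<bar>(\<Sum>j\<in>{1..N}. A k j * m (real j / real N)) - ?c k\<bar>) / real N
      = (\<Sum>k\<in>{1..N}. \<bar>(\<Sum>j\<in>{1..N}. A k j * s j) - ?c k\<bar>) / real N"
    by (simp add: s_def)
  also have "\<dots> \<le> \<delta> + set_lebesgue_integral lborel {0..1} (\<lambda>a. \<bar>?ws a - ?c (cell N a)\<bar>)"
    by (rule average_graph_agg_close[OF s1])
  also have "set_lebesgue_integral lborel {0..1} (\<lambda>a. \<bar>?ws a - ?c (cell N a)\<bar>)
      \<le> set_lebesgue_integral lborel {0..1} (\<lambda>a. C * ?I + \<bar>?c (cell N a) - wint m a\<bar>)"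
  proof (rule set_integral_mono)
    show "set_integrable lborel {0..1} (\<lambda>a. \<bar>?ws a - ?c (cell N a)\<bar>)"
      by (intro set_integrable_abs set_integral_diff wint_cell_integrable[OF s1]
          set_integral_cell(1)[OF N_pos, of ?c])
    show "set_integrable lborel {0..1} (\<lambda>a. C * ?I + \<bar>?c (cell N a) - wint m a\<bar>)"
      by (intro set_integral_add set_integrable_abs set_integral_diff w_int
          set_integral_cell(1)[OF N_pos, of ?c] set_integral_cell(1)[OF N_pos, of "\<lambda>_. C * ?I"])
    show "\<bar>?ws a - ?c (cell N a)\<bar> \<le> C * ?I + \<bar>?c (cell N a) - wint m a\<bar>" if "a \<in> {0..1}" for a
      using diff[OF that] by linarith
  qed
  also have "\<dots> = set_lebesgue_integral lborel {0..1::real} (\<lambda>a. C * ?I)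
      + set_lebesgue_integral lborel {0..1} (\<lambda>a. \<bar>?c (cell N a) - wint m a\<bar>)"
    by (intro set_integral_add set_integrable_abs set_integral_diff w_int
          set_integral_cell(1)[OF N_pos, of ?c] set_integral_cell(1)[OF N_pos, of "\<lambda>_. C * ?I"])
  also have "set_lebesgue_integral lborel {0..1::real} (\<lambda>a. C * ?I) = C * ?I"
    by (simp add: set_lebesgue_integral_def)
  finally show ?thesis by simp
qed

section \<open>Vertices of exceptionally large degree\<close>

definition Bad :: "nat set" where "Bad = {k \<in> {1..N}. deg k > 2 * C}"

text \<open>Bad agents are never shown to stay coupled; their influence on agent \<open>k\<close> is
  bounded by this mass times the trivial probability 1.\<close>

definition bad_mass :: "nat \<Rightarrow> real" where "bad_mass k = (\<Sum>j\<in>Bad. A k j)"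

lemma Bad_subset: "Bad \<subseteq> {1..N}"
  by (auto simp: Bad_def)

text \<open>The threshold \<open>2 * C\<close> makes at least half of the degree of a bad vertex an
  excess over \<open>C\<close>, so the excess bound controls the whole degree.\<close>

lemma sum_deg_Bad: "(\<Sum>k\<in>Bad. deg k) \<le> 2 * \<delta> * real N"
proof -
  have "(\<Sum>k\<in>Bad. deg k) \<le> (\<Sum>k\<in>Bad. 2 * max 0 (deg k - C))"
  proof (rule sum_mono)
    fix k assume "k \<in> Bad"
    then have "deg k > 2 * C" by (simp add: Bad_def)
    then show "deg k \<le> 2 * max 0 (deg k - C)" using C_pos by (simp add: max_def)
  qed
  also have "\<dots> \<le> (\<Sum>k\<in>{1..N}. 2 * max 0 (deg k - C))"
    by (intro sum_mono2) (auto simp: Bad_def)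
  also have "\<dots> = 2 * (\<Sum>k\<in>{1..N}. max 0 (deg k - C))" by (simp add: sum_distrib_left)
  finally show ?thesis using average_excess_degree_le N_pos by (simp add: divide_le_eq)
qed

lemma card_Bad: "real (card Bad) \<le> \<delta> / C * real N"
proof -
  have "real (card Bad) * (2 * C) = (\<Sum>k\<in>Bad. 2 * C)" by simp
  also have "\<dots> \<le> (\<Sum>k\<in>Bad. deg k)" by (intro sum_mono) (auto simp: Bad_def)
  also note sum_deg_Bad
  finally show ?thesis using C_pos by (simp add: field_simps)
qed

lemma bad_mass_nonneg: "0 \<le> bad_mass k"
  unfolding bad_mass_def by (intro sum_nonneg A_nonneg)

text \<open>By symmetry, the weight that all vertices place on bad ones is the total degree of the
  bad ones.\<close>

lemma sum_bad_mass: "(\<Sum>k\<in>{1..N}. bad_mass k) \<le> 2 * \<delta> * real N"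
proof -
  have "(\<Sum>k\<in>{1..N}. bad_mass k) = (\<Sum>j\<in>Bad. \<Sum>k\<in>{1..N}. A k j)"
    unfolding bad_mass_def by (rule sum.swap)
  also have "\<dots> = (\<Sum>j\<in>Bad. deg j)" unfolding deg_def by (intro sum.cong refl A_sym)
  finally show ?thesis using sum_deg_Bad by simp
qed

section \<open>Non-isolated vertices and the size of a single edge weight\<close>

definition NonIsolated :: "nat set" where "NonIsolated = {k \<in> {1..N}. \<exists>j\<in>{1..N}. E k j}"

text \<open>Every edge contributes at least \<theta> to the sum of the degrees. Isolated vertices
  contribute nothing to that sum, the others at most \<open>C\<close> beyond their excess. An edge
  density comparable to \<open>rhoN\<close> thus forces many vertices to have neighbours.\<close>

lemma edge_density_le: "real (num_edges E N) / real N ^ 2 / rhoN \<le> \<delta> + C * (real (card NonIsolated) / real N)"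
proof -
  let ?P = "{(i, j). i \<in> {1..N} \<and> j \<in> {1..N} \<and> i < j \<and> E i j}"
  have sub: "?P \<subseteq> {1..N} \<times> {1..N}" by auto
  have "(\<Sum>z\<in>?P. A (fst z) (snd z)) = (\<Sum>z\<in>?P. \<theta>)"
    by (rule sum.cong) (auto simp: A_def \<theta>_def)
  then have "real (num_edges E N) * \<theta> = (\<Sum>z\<in>?P. A (fst z) (snd z))"
    unfolding num_edges_def by simp
  also have "\<dots> \<le> (\<Sum>z\<in>{1..N} \<times> {1..N}. A (fst z) (snd z))"
    by (intro sum_mono2) (use sub A_nonneg in auto)
  also have "\<dots> = (\<Sum>k\<in>{1..N}. deg k)"
    by (simp add: deg_def sum.cartesian_product case_prod_unfold)
  also have "\<dots> \<le> (\<Sum>k\<in>{1..N}. max 0 (deg k - C) + (if k \<in> NonIsolated then C else 0))"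
  proof (rule sum_mono)
    fix k assume k: "k \<in> {1..N}"
    show "deg k \<le> max 0 (deg k - C) + (if k \<in> NonIsolated then C else 0)"
    proof (cases "k \<in> NonIsolated")
      case False
      then have "deg k = 0" using k by (auto simp: deg_def A_def NonIsolated_def)
      then show ?thesis using False by simp
    qed auto
  qed
  also have "\<dots> = (\<Sum>k\<in>{1..N}. max 0 (deg k - C)) + C * real (card NonIsolated)"
  proof -
    have "NonIsolated \<subseteq> {1..N}" by (auto simp: NonIsolated_def)
    then show ?thesis by (simp add: sum.distrib sum.If_cases Int_absorb1)
  qed
  also have "\<dots> \<le> \<delta> * real N + C * real (card NonIsolated)"
    using average_excess_degree_le N_pos by (simp add: divide_le_eq)
  finally have "real (num_edges E N) * \<theta> / real N \<le> (\<delta> * real N + C * real (card NonIsolated)) / real N"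
    by (rule divide_right_mono) simp
  moreover have "real (num_edges E N) * \<theta> / real N = real (num_edges E N) / real N ^ 2 / rhoN"
    by (simp add: \<theta>_def power2_eq_square)
  moreover have "(\<delta> * real N + C * real (card NonIsolated)) / real N = \<delta> + C * (real (card NonIsolated) / real N)"
    using N_pos by (simp add: field_simps)
  ultimately show ?thesis by simp
qed

text \<open>The limiting counterpart of the entries of \<open>A\<close>: on step functions the
  graphon operator is a finite weighted sum with these coefficients, each of order
  \<open>1 / N\<close>.\<close>

definition cell_weight :: "nat \<Rightarrow> real \<Rightarrow> real" where
  "cell_weight j a = wint (\<lambda>b. if cell N b = j then 1 else 0) a"

lemma cell_weight_le:
  assumes a: "a \<in> {0..1}"
  shows "\<bar>cell_weight j a\<bar> \<le> C * (if j \<in> {1..N} then 1 / real N else 0)"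
proof -
  have "\<bar>cell_weight j a\<bar> \<le> C * set_lebesgue_integral lborel {0..1} (\<lambda>b. \<bar>if cell N b = j then 1 else 0\<bar>)"
    unfolding cell_weight_def
    by (rule wint_abs_le_integral[OF measurable_cell_fun[of "\<lambda>k. if k = j then 1 else 0"] _ a, of 1]) auto
  also have "set_lebesgue_integral lborel {0..1} (\<lambda>b. \<bar>if cell N b = j then 1 else 0\<bar>)
      = (\<Sum>k\<in>{1..N}. \<bar>if k = j then 1 else 0\<bar>) / real N"
    by (rule set_integral_cell(2)[OF N_pos])
  also have "(\<Sum>k\<in>{1..N}. \<bar>if k = j then 1 else (0::real)\<bar>) = (\<Sum>k\<in>{1..N}. if k = j then 1 else 0)"
    by (intro sum.cong) auto
  finally show ?thesis by auto
qed

lemma wint_cell_eq_sum: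
  assumes a: "a \<in> {0..1}"
  shows "wint (\<lambda>b. s (cell N b)) a = (\<Sum>j\<in>{1..N}. cell_weight j a * s j)"
proof -
  have int: "set_integrable lborel {0..1} (\<lambda>b. W a b * (if cell N b = j then 1 else 0))" for j
    by (rule wint_integrable[OF measurable_cell_fun[of "\<lambda>k. if k = j then 1 else 0"] _ a, of 1]) auto
  \<comment> \<open>The index 0 must be included because it occurs at \<open>b = 0\<close>; its
    weight vanishes, as the cell is a single point.\<close>
  have "wint (\<lambda>b. s (cell N b)) a = set_lebesgue_integral lborel {0..1}
      (\<lambda>b. \<Sum>j\<in>{0..N}. s j * (W a b * (if cell N b = j then 1 else 0)))"
    unfolding wint_def
  proof (rule set_lebesgue_integral_cong)
    show "\<forall>b. b \<in> {0..1} \<longrightarrow> W a b * s (cell N b)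
        = (\<Sum>j\<in>{0..N}. s j * (W a b * (if cell N b = j then 1 else 0)))"
      using cell_le[of _ N] by (auto simp: if_distrib cong: if_cong)
  qed simp
  also have "\<dots> = (\<Sum>j\<in>{0..N}. s j * cell_weight j a)"
    unfolding cell_weight_def wint_def
    using int by (simp add: set_lebesgue_integral_def set_integrable_def sum_distrib_left
        Bochner_Integration.integral_sum mult.left_commute)
  also have "\<dots> = (\<Sum>j\<in>{1..N}. s j * cell_weight j a)"
  proof -
    have "cell_weight 0 a = 0" using cell_weight_le[OF a, of 0] by simp
    moreover have "{0..N} = insert 0 {1..N}" by auto
    ultimately show ?thesis by simp
  qed
  finally show ?thesis by (simp add: mult.commute)
qed

text \<open>Random signs: a vertex with a neighbour sees an aggregate of order at least \<open>\<theta>\<close>, whereas the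
  limiting operator averages the signs out. Hence the average degree has to diverge.\<close>

lemma \<theta>_mult_nonisolated_le: "\<theta> * (real (card NonIsolated) / real N) \<le> \<delta> + C / sqrt (real N)"
proof -
  define f :: "bool \<Rightarrow> real" where "f a = (if a then 1 else - 1)" for a
  define q :: "nat \<Rightarrow> bool pmf" where "q j = bernoulli_pmf (1 / 2)" for j
  define p where "p = Pi_pmf {1..N} False q"
  define S where "S X k = (\<Sum>j\<in>{1..N}. A k j * f (X j))" for X k
  define w where "w X = wint (\<lambda>b. f (X (cell N b)))" for X
  let ?E = "measure_pmf.expectation p"
  have fin: "finite (set_pmf p)" unfolding p_def by (rule finite_set_Pi_pmf) simp
  note int = integrable_measure_pmf_finite[OF fin]
  have f1: "\<bar>f a\<bar> \<le> 1" for a by (simp add: f_def)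
  have f0: "measure_pmf.expectation (q j) f = 0" for j
    by (simp add: q_def f_def)
  \<comment> \<open>Correlating the aggregate with the sign of one neighbour \<open>l\<close> leaves
    only the term \<open>A k l = \<theta>\<close>. That sign has modulus 1, so the correlation is at
    most the mean of the modulus of the aggregate.\<close>
  have lower: "\<theta> \<le> ?E (\<lambda>X. \<bar>S X k\<bar>)" if "k \<in> NonIsolated" for k
  proof -
    from that obtain l where l: "l \<in> {1..N}" "E k l" by (auto simp: NonIsolated_def)
    have "?E (\<lambda>X. f (X j) * f (X l)) = (if j = l then 1 else 0)" if j: "j \<in> {1..N}" for j
    proof (cases "j = l")
      case True
      have "f a * f a = 1" for a by (simp add: f_def)
      then show ?thesis using True by simp
    next
      case False
      then show ?thesis unfolding p_def
        by (subst expectation_Pi_pmf_mult[OF _ j l(1) False]) (auto simp: f0)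
    qed
    note cov = this
    have "?E (\<lambda>X. S X k * f (X l)) = (\<Sum>j\<in>{1..N}. A k j * ?E (\<lambda>X. f (X j) * f (X l)))"
      by (simp add: S_def sum_distrib_right int Bochner_Integration.integral_sum mult.assoc)
    also have "\<dots> = (\<Sum>j\<in>{1..N}. if j = l then A k j else 0)"
      by (intro sum.cong refl) (simp add: cov)
    also have "\<dots> = \<theta>" using l by (simp add: A_def \<theta>_def)
    finally have "\<theta> = ?E (\<lambda>X. S X k * f (X l))" ..
    also have "\<dots> \<le> ?E (\<lambda>X. \<bar>S X k\<bar>)"
      by (intro integral_mono int) (auto simp: f_def)
    finally show ?thesis .
  qed
  \<comment> \<open>No cell weighs more than \<open>C / N\<close>, so the second moment of the
    averaged signs is at most \<open>C\<^sup>2 / N\<close>.\<close>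
  have upper: "?E (\<lambda>X. \<bar>w X a\<bar>) \<le> C / sqrt (real N)" if a: "a \<in> {0..1}" for a
  proof -
    have "?E (\<lambda>X. \<bar>w X a\<bar>) = ?E (\<lambda>X. \<bar>\<Sum>j\<in>{1..N}. cell_weight j a * f (X j)\<bar>)"
      unfolding w_def using wint_cell_eq_sum[OF a, of "\<lambda>j. f (_ j)"] by simp
    also have "\<dots> \<le> sqrt (\<Sum>j\<in>{1..N}. (cell_weight j a)\<^sup>2)"
      unfolding p_def by (rule expectation_Pi_pmf_abs_sum_le) (auto simp: f0 f1)
    also have "\<dots> \<le> sqrt (\<Sum>j\<in>{1..N}. (C / real N)\<^sup>2)"
    proof (intro real_sqrt_le_mono sum_mono)
      fix j assume "j \<in> {1..N}"
      then have "\<bar>cell_weight j a\<bar> \<le> C / real N" using cell_weight_le[OF a, of j] by simp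
      then show "(cell_weight j a)\<^sup>2 \<le> (C / real N)\<^sup>2" by (metis abs_ge_zero power2_abs power_mono)
    qed
    also have "(\<Sum>j\<in>{1..N}. (C / real N)\<^sup>2) = C\<^sup>2 / real N"
      by (simp add: power2_eq_square)
    also have "sqrt (C\<^sup>2 / real N) = C / sqrt (real N)"
      using C_pos by (simp add: real_sqrt_divide)
    finally show ?thesis .
  qed
  have w_int: "set_integrable lborel {0..1} (\<lambda>a. \<bar>w X a\<bar>)" for X
    unfolding w_def by (intro set_integrable_abs wint_cell_integrable[OF f1])
  have NI: "NonIsolated \<subseteq> {1..N}" by (auto simp: NonIsolated_def)
  have "\<theta> * real (card NonIsolated) = (\<Sum>k\<in>NonIsolated. \<theta>)" by simp
  also have "\<dots> \<le> (\<Sum>k\<in>NonIsolated. ?E (\<lambda>X. \<bar>S X k\<bar>))" by (intro sum_mono lower)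
  also have "\<dots> \<le> (\<Sum>k\<in>{1..N}. ?E (\<lambda>X. \<bar>S X k\<bar>))"
    by (intro sum_mono2) (use NI in \<open>auto intro!: Bochner_Integration.integral_nonneg\<close>)
  finally have "\<theta> * (real (card NonIsolated) / real N) \<le> (\<Sum>k\<in>{1..N}. ?E (\<lambda>X. \<bar>S X k\<bar>)) / real N"
    by (simp add: divide_right_mono)
  also have "\<dots> = ?E (\<lambda>X. (\<Sum>k\<in>{1..N}. \<bar>S X k\<bar>) / real N)"
    by (simp add: int Bochner_Integration.integral_sum)
  also have "\<dots> \<le> ?E (\<lambda>X. \<delta> + set_lebesgue_integral lborel {0..1} (\<lambda>a. \<bar>w X a\<bar>))"
  proof (intro integral_mono int)
    fix X
    show "(\<Sum>k\<in>{1..N}. \<bar>S X k\<bar>) / real N \<le> \<delta> + set_lebesgue_integral lborel {0..1} (\<lambda>a. \<bar>w X a\<bar>)"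
      using average_graph_agg_close[of "\<lambda>j. f (X j)" "\<lambda>_. 0"] f1 by (simp add: S_def w_def)
  qed
  also have "\<dots> = \<delta> + ?E (\<lambda>X. set_lebesgue_integral lborel {0..1} (\<lambda>a. \<bar>w X a\<bar>))"
    by (simp add: int)
  \<comment> \<open>The signs have a finitely supported law, so the exchange with the integral is
    mere linearity.\<close>
  also have "?E (\<lambda>X. set_lebesgue_integral lborel {0..1} (\<lambda>a. \<bar>w X a\<bar>))
      = set_lebesgue_integral lborel {0..1} (\<lambda>a. ?E (\<lambda>X. \<bar>w X a\<bar>))"
    using w_int unfolding set_integrable_def set_lebesgue_integral_def
    by (simp add: integral_measure_pmf_real[OF fin] Bochner_Integration.integral_sum
        sum_distrib_left flip: mult.assoc)
  also have "\<dots> \<le> C / sqrt (real N)"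
  proof -
    have "\<bar>set_lebesgue_integral lborel {0..1} (\<lambda>a. ?E (\<lambda>X. \<bar>w X a\<bar>))\<bar> \<le> C / sqrt (real N)"
    proof (rule set_lebesgue_integral_unit_interval_bound)
      fix a :: real assume "a \<in> {0..1}"
      moreover have "?E (\<lambda>X. \<bar>w X a\<bar>) \<ge> 0" by (rule Bochner_Integration.integral_nonneg) simp
      ultimately show "\<bar>?E (\<lambda>X. \<bar>w X a\<bar>)\<bar> \<le> C / sqrt (real N)" using upper by simp
    qed
    then show ?thesis by simp
  qed
  finally show ?thesis by simp
qed

end

section \<open>Coupling the game with independent mean field agents\<close>

text \<open>Choosing one coupling for every pair of laws allows it to be used inside the recursion
  \<open>coupled\<close>.\<close>

definition coupling :: "'a::finite pmf \<Rightarrow> 'a pmf \<Rightarrow> ('a \<times> 'a) pmf" where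
  "coupling p q = (SOME w. map_pmf fst w = p \<and> map_pmf snd w = q \<and>
    measure_pmf.prob w {z. fst z \<noteq> snd z} \<le> (\<Sum>a\<in>UNIV. \<bar>pmf p a - pmf q a\<bar>))"

lemma map_fst_coupling: "map_pmf fst (coupling p q) = p"
  and map_snd_coupling: "map_pmf snd (coupling p q) = q"
  and prob_coupling_neq: "measure_pmf.prob (coupling p q) {z. fst z \<noteq> snd z} \<le> (\<Sum>a\<in>UNIV. \<bar>pmf p a - pmf q a\<bar>)"
  using someI_ex[OF maximal_coupling[of p q]] unfolding coupling_def by auto

text \<open>Two copies in the same state draw their action from the same law, so averaging over it
  does not increase the distance between the kernels, whatever the policy is.\<close>

lemma bind_pmf_l1_lipschitz:
  fixes p :: "'u::finite pmf" and f g :: "'u \<Rightarrow> 'x::finite pmf"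
  assumes "\<And>u. (\<Sum>z\<in>UNIV. \<bar>pmf (f u) z - pmf (g u) z\<bar>) \<le> B"
  shows "(\<Sum>z\<in>UNIV. \<bar>pmf (bind_pmf p f) z - pmf (bind_pmf p g) z\<bar>) \<le> B"
proof -
  note int = integrable_measure_pmf_finite[of p, OF finite]
  have "(\<Sum>z\<in>UNIV. \<bar>pmf (bind_pmf p f) z - pmf (bind_pmf p g) z\<bar>)
      = (\<Sum>z\<in>UNIV. \<bar>measure_pmf.expectation p (\<lambda>u. pmf (f u) z - pmf (g u) z)\<bar>)"
    by (simp add: pmf_bind int)
  also have "\<dots> \<le> (\<Sum>z\<in>UNIV. measure_pmf.expectation p (\<lambda>u. \<bar>pmf (f u) z - pmf (g u) z\<bar>))"
    by (intro sum_mono integral_abs_bound)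
  also have "\<dots> = measure_pmf.expectation p (\<lambda>u. \<Sum>z\<in>UNIV. \<bar>pmf (f u) z - pmf (g u) z\<bar>)"
    by (simp add: int Bochner_Integration.integral_sum)
  also have "\<dots> \<le> measure_pmf.expectation p (\<lambda>_. B)"
    by (intro integral_mono int assms)
  finally show ?thesis by simp
qed

section \<open>Error quantities that do not involve the deviation\<close>

locale graph_game = graph_near_graphon W C L D E N rhoN
  for W C L D E N rhoN +
  fixes P :: "'x::finite \<Rightarrow> 'u::finite \<Rightarrow> ('x \<Rightarrow> real) \<Rightarrow> 'x pmf"
    and r :: "'x \<Rightarrow> 'u \<Rightarrow> ('x \<Rightarrow> real) \<Rightarrow> real"
    and mu0 :: "'x pmf" and mu :: "nat \<Rightarrow> real \<Rightarrow> 'x \<Rightarrow> real" and LP Lr M :: real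
  assumes LP_nonneg: "LP \<ge> 0" and Lr_nonneg: "Lr \<ge> 0"
    and P_lipschitz: "(\<forall>y. 0 \<le> g y) \<Longrightarrow> (\<forall>y. 0 \<le> g' y) \<Longrightarrow>
      (\<Sum>z\<in>UNIV. \<bar>pmf (P x u g) z - pmf (P x u g') z\<bar>) \<le> LP * (\<Sum>y\<in>UNIV. \<bar>g y - g' y\<bar>)"
    and r_lipschitz: "(\<forall>y. 0 \<le> g y) \<Longrightarrow> (\<forall>y. 0 \<le> g' y) \<Longrightarrow>
      \<bar>r x u g - r x u g'\<bar> \<le> Lr * (\<Sum>y\<in>UNIV. \<bar>g y - g' y\<bar>)"
    and mu_nonneg: "a \<in> {0..1} \<Longrightarrow> 0 \<le> mu t a x"
    and mu_le_1: "a \<in> {0..1} \<Longrightarrow> mu t a x \<le> 1"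
    and r_bound: "a \<in> {0..1} \<Longrightarrow> \<bar>r x u (graphon_agg W (mu t) a)\<bar> \<le> M"
begin

definition G :: "nat \<Rightarrow> nat \<Rightarrow> 'x \<Rightarrow> real" where
  "G t k = graphon_agg W (mu t) (real k / real N)"

definition emp :: "(nat \<Rightarrow> 'x) \<Rightarrow> nat \<Rightarrow> 'x \<Rightarrow> real" where
  "emp X k = emp_nbhd E rhoN N X k"

lemma emp_eq: "emp X k x = (\<Sum>j\<in>{1..N}. A k j * of_bool (X j = x))"
  unfolding emp_def emp_nbhd_def A_def sum_divide_distrib
  by (intro sum.cong) auto

lemma emp_nonneg: "0 \<le> emp X k x"
  unfolding emp_eq by (intro sum_nonneg mult_nonneg_nonneg A_nonneg) auto

lemma grid_in_unit: "k \<in> {1..N} \<Longrightarrow> real k / real N \<in> {0..1}"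
  using N_pos by (auto simp: divide_le_eq_1)

lemma G_nonneg: "k \<in> {1..N} \<Longrightarrow> 0 \<le> G t k x"
  unfolding G_def graphon_agg_eq_wint using grid_in_unit mu_nonneg by (intro wint_nonneg) auto

text \<open>A neighbour in a different state takes weight from one state and adds it to another,
  hence the factor 2.\<close>

lemma emp_diff_le:
  "(\<Sum>x\<in>UNIV. \<bar>emp X k x - emp Y k x\<bar>) \<le> 2 * (\<Sum>j\<in>{1..N}. A k j * of_bool (X j \<noteq> Y j))"
proof -
  have "(\<Sum>x\<in>UNIV. \<bar>emp X k x - emp Y k x\<bar>)
      \<le> (\<Sum>x\<in>UNIV. \<Sum>j\<in>{1..N}. A k j * \<bar>of_bool (X j = x) - of_bool (Y j = x)\<bar>)"
  proof (rule sum_mono)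
    fix x
    have "\<bar>emp X k x - emp Y k x\<bar> = \<bar>\<Sum>j\<in>{1..N}. A k j * (of_bool (X j = x) - of_bool (Y j = x))\<bar>"
      by (simp add: emp_eq sum_subtractf right_diff_distrib)
    also have "\<dots> \<le> (\<Sum>j\<in>{1..N}. \<bar>A k j * (of_bool (X j = x) - of_bool (Y j = x))\<bar>)"
      by (rule sum_abs)
    finally show "\<bar>emp X k x - emp Y k x\<bar> \<le> (\<Sum>j\<in>{1..N}. A k j * \<bar>of_bool (X j = x) - of_bool (Y j = x)\<bar>)"
      by (simp add: abs_mult A_nonneg)
  qed
  also have "\<dots> = (\<Sum>j\<in>{1..N}. A k j * (\<Sum>x\<in>UNIV. \<bar>of_bool (X j = x) - of_bool (Y j = x)\<bar>))"
    by (subst sum.swap) (simp add: sum_distrib_left)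
  also have "\<dots> \<le> (\<Sum>j\<in>{1..N}. A k j * (2 * of_bool (X j \<noteq> Y j)))"
  proof (intro sum_mono mult_left_mono A_nonneg)
    fix j
    have "(\<Sum>x\<in>UNIV. \<bar>of_bool (X j = x) - of_bool (Y j = x)\<bar>)
       \<le> (\<Sum>x\<in>UNIV. of_bool (X j \<noteq> Y j) * (of_bool (X j = x) + of_bool (Y j = x) :: real))"
      by (intro sum_mono) auto
    also have "\<dots> = 2 * of_bool (X j \<noteq> Y j)"
      by (simp add: sum.distrib of_bool_def flip: sum_distrib_left)
    finally show "(\<Sum>x\<in>UNIV. \<bar>of_bool (X j = x) - of_bool (Y j = x)\<bar>) \<le> (2 * of_bool (X j \<noteq> Y j) :: real)" .
  qed
  also have "\<dots> = 2 * (\<Sum>j\<in>{1..N}. A k j * of_bool (X j \<noteq> Y j))"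
    unfolding sum_distrib_left by (rule sum.cong) auto
  finally show ?thesis .
qed

definition mf_error :: "nat \<Rightarrow> nat \<Rightarrow> real" where
  "mf_error t k = (\<Sum>x\<in>UNIV. \<bar>(\<Sum>j\<in>{1..N}. A k j * mu t (real j / real N) x) - G t k x\<bar>)"

text \<open>The root is the law of large numbers at a good vertex, whose squared weights sum to at
  most \<open>2 * C * \<theta>\<close>. The additional \<theta> pays for the one agent whose law
  need not be the mean field.\<close>

definition noise :: real where
  "noise = real CARD('x) * (sqrt (2 * C * \<theta>) + \<theta>)"

definition Good :: "nat set" where "Good = {1..N} - Bad"

text \<open>Here \<open>h\<close> stands for bounds on the decoupling probabilities of good agents,
  while bad agents are all counted as decoupled. The factors 2 come from
  \<open>emp_diff_le\<close>.\<close>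

definition agg_bound :: "(nat \<Rightarrow> real) \<Rightarrow> nat \<Rightarrow> nat \<Rightarrow> real" where
  "agg_bound h t k = 2 * bad_mass k + 2 * (\<Sum>j\<in>Good. A k j * h j) + mf_error t k + noise"

text \<open>Upper bounds for the probability that agent \<open>k\<close> has decoupled from its mean field copy by time
  \<open>t\<close>. They depend neither on the deviating agent nor on its policy.\<close>

primrec decoupled_bound :: "nat \<Rightarrow> nat \<Rightarrow> real" where
  "decoupled_bound 0 = (\<lambda>k. 0)"
| "decoupled_bound (Suc t) = (\<lambda>k. decoupled_bound t k + LP * agg_bound (decoupled_bound t) t k)"

lemma noise_nonneg: "0 \<le> noise"
  using \<theta>_pos C_pos by (simp add: noise_def)

lemma mf_error_nonneg: "0 \<le> mf_error t k"
  unfolding mf_error_def by (intro sum_nonneg) auto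

lemma agg_bound_nonneg: "(\<And>j. 0 \<le> h j) \<Longrightarrow> 0 \<le> agg_bound h t k"
  unfolding agg_bound_def
  by (intro add_nonneg_nonneg mult_nonneg_nonneg sum_nonneg bad_mass_nonneg A_nonneg mf_error_nonneg noise_nonneg) auto

lemma decoupled_bound_nonneg: "0 \<le> decoupled_bound t k"
  by (induction t arbitrary: k) (auto intro!: add_nonneg_nonneg mult_nonneg_nonneg LP_nonneg agg_bound_nonneg)

text \<open>After exchanging the sums, symmetry makes the column sum at a good \<open>j\<close> part
  of its degree, hence at most \<open>2 * C\<close>. The averaged recursion then involves good
  agents only.\<close>

lemma sum_agg_bound_le:
  assumes h: "\<And>j. 0 \<le> h j"
  shows "(\<Sum>k\<in>Good. agg_bound h t k) / real N
    \<le> 4 * \<delta> + 4 * C * ((\<Sum>k\<in>Good. h k) / real N) + (\<Sum>k\<in>{1..N}. mf_error t k) / real N + noise"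
proof -
  have fin: "finite Good" "Good \<subseteq> {1..N}" by (auto simp: Good_def)
  have "(\<Sum>k\<in>Good. bad_mass k) \<le> (\<Sum>k\<in>{1..N}. bad_mass k)"
    by (intro sum_mono2 fin bad_mass_nonneg) auto
  also note sum_bad_mass
  finally have b: "(\<Sum>k\<in>Good. bad_mass k) \<le> 2 * \<delta> * real N" .
  have "(\<Sum>k\<in>Good. \<Sum>j\<in>Good. A k j * h j) = (\<Sum>j\<in>Good. (\<Sum>k\<in>Good. A k j) * h j)"
    by (subst sum.swap) (simp add: sum_distrib_right)
  also have "\<dots> \<le> (\<Sum>j\<in>Good. (2 * C) * h j)"
  proof (intro sum_mono mult_right_mono h)
    fix j assume j: "j \<in> Good"
    have "(\<Sum>k\<in>Good. A k j) = (\<Sum>k\<in>Good. A j k)" by (intro sum.cong refl A_sym)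
    also have "\<dots> \<le> deg j" unfolding deg_def by (intro sum_mono2 fin A_nonneg) auto
    also have "\<dots> \<le> 2 * C" using j by (auto simp: Good_def Bad_def)
    finally show "(\<Sum>k\<in>Good. A k j) \<le> 2 * C" .
  qed
  finally have a: "(\<Sum>k\<in>Good. \<Sum>j\<in>Good. A k j * h j) \<le> 2 * C * (\<Sum>j\<in>Good. h j)"
    by (simp add: sum_distrib_left)
  have e: "(\<Sum>k\<in>Good. mf_error t k) \<le> (\<Sum>k\<in>{1..N}. mf_error t k)"
    by (intro sum_mono2 fin mf_error_nonneg) auto
  have "card Good \<le> N" using card_mono[OF _ fin(2)] by simp
  then have n: "real (card Good) * noise \<le> real N * noise"
    using noise_nonneg by (intro mult_right_mono) auto
  have "(\<Sum>k\<in>Good. agg_bound h t k) = 2 * (\<Sum>k\<in>Good. bad_mass k)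
      + 2 * (\<Sum>k\<in>Good. \<Sum>j\<in>Good. A k j * h j) + (\<Sum>k\<in>Good. mf_error t k) + real (card Good) * noise"
    by (simp add: agg_bound_def sum.distrib sum_distrib_left)
  also have "\<dots> \<le> (4 * \<delta> + noise) * real N + 4 * C * (\<Sum>k\<in>Good. h k) + (\<Sum>k\<in>{1..N}. mf_error t k)"
    using a b e n by (simp add: algebra_simps)
  finally have "(\<Sum>k\<in>Good. agg_bound h t k) / real N
     \<le> ((4 * \<delta> + noise) * real N + 4 * C * (\<Sum>k\<in>Good. h k) + (\<Sum>k\<in>{1..N}. mf_error t k)) / real N"
    by (rule divide_right_mono) simp
  also have "\<dots> = 4 * \<delta> + 4 * C * ((\<Sum>k\<in>Good. h k) / real N) + (\<Sum>k\<in>{1..N}. mf_error t k) / real N + noise"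
    using N_pos by (simp add: add_divide_distrib)
  finally show ?thesis .
qed

end

section \<open>The coupled process with one agent free to deviate\<close>

locale deviated_game = graph_game W C L D E N rhoN P r mu0 mu LP Lr M
  for W C L D E N rhoN and P :: "'x::finite \<Rightarrow> 'u::finite \<Rightarrow> ('x \<Rightarrow> real) \<Rightarrow> 'x pmf"
    and r mu0 mu LP Lr M +
  fixes pis :: "nat \<Rightarrow> nat \<Rightarrow> 'x \<Rightarrow> 'u pmf" and i :: nat
  assumes agent_law_eq_mu: "k \<in> {1..N} \<Longrightarrow> k \<noteq> i \<Longrightarrow>
    pmf (agent_law P mu0 W mu (real k / real N) (pis k) t) x = mu t (real k / real N) x"
begin

text \<open>For the deviator this is the law of a mean field agent under the policy actually played,
  so its game return is compared with the mean field return of the same policy.\<close>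

definition alaw :: "nat \<Rightarrow> nat \<Rightarrow> 'x pmf" where
  "alaw t k = agent_law P mu0 W mu (real k / real N) (pis k) t"

definition game_step :: "nat \<Rightarrow> (nat \<Rightarrow> 'x) \<Rightarrow> nat \<Rightarrow> 'x pmf" where
  "game_step t X k = bind_pmf (pis k t (X k)) (\<lambda>u. P (X k) u (emp X k))"

definition mf_step :: "nat \<Rightarrow> 'x \<Rightarrow> nat \<Rightarrow> 'x pmf" where
  "mf_step t z k = bind_pmf (pis k t z) (\<lambda>u. P z u (G t k))"

text \<open>Given the present pairs, the next pairs are drawn independently over the agents. First
  coordinates interact through \<open>emp\<close>, while the second coordinate of an agent moves by
  its own state and the limiting aggregate.\<close>

primrec coupled :: "nat \<Rightarrow> (nat \<Rightarrow> 'x \<times> 'x) pmf" where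
  "coupled 0 = Pi_pmf {1..N} (undefined, undefined) (\<lambda>k. map_pmf (\<lambda>x. (x, x)) mu0)"
| "coupled (Suc t) = bind_pmf (coupled t) (\<lambda>F. Pi_pmf {1..N} (undefined, undefined)
     (\<lambda>k. coupling (game_step t (fst \<circ> F) k) (mf_step t (snd (F k)) k)))"

lemma finite_coupled: "finite (set_pmf (coupled t))"
  by (induction t) (auto intro!: finite_set_Pi_pmf)

lemma coupled_fst: "map_pmf (\<lambda>F. fst \<circ> F) (coupled t) = joint_law P mu0 E rhoN N pis t"
proof (induction t)
  case 0
  show ?case
    by (simp add: pmf.map_comp o_def flip: Pi_pmf_map[where f = fst and dflt' = undefined, simplified o_def])
next
  case (Suc t)
  have "map_pmf (\<lambda>F. fst \<circ> F) (coupled (Suc t))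
     = bind_pmf (coupled t) (\<lambda>F. Pi_pmf {1..N} undefined (\<lambda>k. map_pmf fst
        (coupling (game_step t (fst \<circ> F) k) (mf_step t (snd (F k)) k))))"
    by (simp add: map_bind_pmf Pi_pmf_map[where dflt = "(undefined, undefined)"])
  also have "\<dots> = bind_pmf (coupled t) (\<lambda>F. Pi_pmf {1..N} undefined (\<lambda>k. game_step t (fst \<circ> F) k))"
    by (simp add: map_fst_coupling)
  also have "\<dots> = bind_pmf (map_pmf (\<lambda>F. fst \<circ> F) (coupled t)) (\<lambda>X. Pi_pmf {1..N} undefined (\<lambda>k. game_step t X k))"
    by (simp add: bind_map_pmf)
  finally show ?case unfolding Suc by (simp only: joint_law.simps game_step_def emp_def)
qed

text \<open>\<open>mf_step\<close> reads only the agent's own second coordinate, so a product law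
  stays a product law, however the first coordinates depend on each other.\<close>

lemma coupled_snd: "map_pmf (\<lambda>F. snd \<circ> F) (coupled t) = Pi_pmf {1..N} undefined (alaw t)"
proof (induction t)
  case 0
  show ?case
    by (simp add: alaw_def pmf.map_comp o_def flip: Pi_pmf_map[where f = snd and dflt' = undefined, simplified o_def])
next
  case (Suc t)
  have "map_pmf (\<lambda>F. snd \<circ> F) (coupled (Suc t))
     = bind_pmf (coupled t) (\<lambda>F. Pi_pmf {1..N} undefined (\<lambda>k. map_pmf snd
        (coupling (game_step t (fst \<circ> F) k) (mf_step t (snd (F k)) k))))"
    by (simp add: map_bind_pmf Pi_pmf_map[where dflt = "(undefined, undefined)"])
  also have "\<dots> = bind_pmf (coupled t) (\<lambda>F. Pi_pmf {1..N} undefined (\<lambda>k. mf_step t ((snd \<circ> F) k) k))"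
    by (simp add: map_snd_coupling)
  also have "\<dots> = bind_pmf (map_pmf (\<lambda>F. snd \<circ> F) (coupled t)) (\<lambda>Z. Pi_pmf {1..N} undefined (\<lambda>k. mf_step t (Z k) k))"
    by (simp add: bind_map_pmf)
  also have "\<dots> = Pi_pmf {1..N} undefined (\<lambda>k. bind_pmf (alaw t k) (\<lambda>z. mf_step t z k))"
    unfolding Suc by (simp add: Pi_pmf_bind[where d' = undefined])
  also have "(\<lambda>k. bind_pmf (alaw t k) (\<lambda>z. mf_step t z k)) = alaw (Suc t)"
    by (simp add: fun_eq_iff alaw_def mf_step_def G_def)
  finally show ?case .
qed

definition decoupled :: "nat \<Rightarrow> nat \<Rightarrow> real" where
  "decoupled t k = measure_pmf.expectation (coupled t) (\<lambda>F. of_bool (fst (F k) \<noteq> snd (F k)))"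

definition agg_error :: "nat \<Rightarrow> nat \<Rightarrow> real" where
  "agg_error t k = measure_pmf.expectation (coupled t) (\<lambda>F. \<Sum>x\<in>UNIV. \<bar>emp (fst \<circ> F) k x - G t k x\<bar>)"

lemma integrable_coupled: "integrable (measure_pmf (coupled t)) (f :: _ \<Rightarrow> real)"
  by (rule integrable_measure_pmf_finite[OF finite_coupled])

lemma decoupled_le_1: "decoupled t k \<le> 1"
proof -
  have "decoupled t k \<le> measure_pmf.expectation (coupled t) (\<lambda>_. 1)"
    unfolding decoupled_def by (intro integral_mono integrable_coupled) auto
  then show ?thesis by simp
qed

lemma decoupled_0: "k \<in> {1..N} \<Longrightarrow> decoupled 0 k = 0"
  unfolding decoupled_def coupled.simps
  by (subst expectation_Pi_pmf_component[where f = "\<lambda>z. of_bool (fst z \<noteq> snd z)"]) (auto simp: integral_map_pmf)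

text \<open>While the copies agree, their transition laws differ only through the aggregate, and the
  coupling separates them with probability at most the distance of these laws. If they already
  differ, the trivial bound 1 is charged to \<open>decoupled t k\<close>.\<close>

lemma decoupled_Suc:
  assumes k: "k \<in> {1..N}"
  shows "decoupled (Suc t) k \<le> decoupled t k + LP * agg_error t k"
proof -
  let ?c = "\<lambda>F k. coupling (game_step t (fst \<circ> F) k) (mf_step t (snd (F k)) k)"
  have "decoupled (Suc t) k = measure_pmf.expectation (coupled t)
     (\<lambda>F. measure_pmf.expectation (Pi_pmf {1..N} (undefined, undefined) (?c F)) (\<lambda>F'. of_bool (fst (F' k) \<noteq> snd (F' k))))"
    unfolding decoupled_def coupled.simps
    by (rule expectation_bind_pmf_finite[OF finite_coupled finite_set_Pi_pmf]) auto
  also have "\<dots> = measure_pmf.expectation (coupled t) (\<lambda>F. measure_pmf.prob (?c F k) {z. fst z \<noteq> snd z})"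
  proof (rule Bochner_Integration.integral_cong[OF refl])
    fix F
    have "measure_pmf.expectation (Pi_pmf {1..N} (undefined, undefined) (?c F)) (\<lambda>F'. of_bool (fst (F' k) \<noteq> snd (F' k)))
      = measure_pmf.expectation (?c F k) (\<lambda>z. of_bool (fst z \<noteq> snd z) :: real)"
      by (rule expectation_Pi_pmf_component[where f = "\<lambda>z. of_bool (fst z \<noteq> snd z)"]) (use k in auto)
    also have "\<dots> = measure_pmf.expectation (?c F k) (indicat_real {z. fst z \<noteq> snd z})"
      by (intro Bochner_Integration.integral_cong) auto
    finally show "measure_pmf.expectation (Pi_pmf {1..N} (undefined, undefined) (?c F)) (\<lambda>F'. of_bool (fst (F' k) \<noteq> snd (F' k)))
      = measure_pmf.prob (?c F k) {z. fst z \<noteq> snd z}" by simp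
  qed
  also have "\<dots> \<le> measure_pmf.expectation (coupled t) (\<lambda>F. of_bool (fst (F k) \<noteq> snd (F k))
       + LP * (\<Sum>x\<in>UNIV. \<bar>emp (fst \<circ> F) k x - G t k x\<bar>))"
  proof (intro integral_mono integrable_coupled)
    fix F
    show "measure_pmf.prob (?c F k) {z. fst z \<noteq> snd z} \<le> of_bool (fst (F k) \<noteq> snd (F k))
       + LP * (\<Sum>x\<in>UNIV. \<bar>emp (fst \<circ> F) k x - G t k x\<bar>)"
    proof (cases "fst (F k) = snd (F k)")
      case True
      have "measure_pmf.prob (?c F k) {z. fst z \<noteq> snd z}
          \<le> (\<Sum>a\<in>UNIV. \<bar>pmf (game_step t (fst \<circ> F) k) a - pmf (mf_step t (snd (F k)) k) a\<bar>)"
        by (rule prob_coupling_neq)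
      also have "\<dots> \<le> LP * (\<Sum>x\<in>UNIV. \<bar>emp (fst \<circ> F) k x - G t k x\<bar>)"
        unfolding game_step_def mf_step_def o_def True
        by (rule bind_pmf_l1_lipschitz, rule P_lipschitz) (use k in \<open>auto intro: emp_nonneg G_nonneg\<close>)
      finally show ?thesis using True by simp
    next
      case False
      have "measure_pmf.prob (?c F k) {z. fst z \<noteq> snd z} \<le> 1 + 0" by simp
      also have "\<dots> \<le> of_bool (fst (F k) \<noteq> snd (F k)) + LP * (\<Sum>x\<in>UNIV. \<bar>emp (fst \<circ> F) k x - G t k x\<bar>)"
        using False by (intro add_mono mult_nonneg_nonneg LP_nonneg sum_nonneg) auto
      finally show ?thesis .
    qed
  qed
  also have "\<dots> = decoupled t k + LP * agg_error t k"
    unfolding decoupled_def agg_error_def by (simp add: integrable_coupled)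
  finally show ?thesis .
qed

text \<open>The error splits into centred independent fluctuations, the discrepancy between the
  agents' laws and the mean field, and the deterministic sampling error.\<close>

lemma independent_agg_error:
  assumes k: "k \<in> Good"
  shows "measure_pmf.expectation (Pi_pmf {1..N} undefined (alaw t)) (\<lambda>Z. \<bar>emp Z k x - G t k x\<bar>)
    \<le> sqrt (2 * C * \<theta>) + \<theta> + \<bar>(\<Sum>j\<in>{1..N}. A k j * mu t (real j / real N) x) - G t k x\<bar>"
proof -
  let ?E = "measure_pmf.expectation (Pi_pmf {1..N} undefined (alaw t))"
  let ?m = "\<lambda>j. mu t (real j / real N) x"
  define f where "f j = (\<lambda>z. of_bool (z = x) - pmf (alaw t j) x)" for j
  note int = integrable_measure_pmf_finite[OF finite_set_Pi_pmf[OF finite_atLeastAtMost]]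
  have mean: "measure_pmf.expectation (alaw t j) (f j) = 0" for j
  proof -
    have "measure_pmf.expectation (alaw t j) (\<lambda>z. of_bool (z = x)) = measure_pmf.expectation (alaw t j) (indicat_real {x})"
      by (intro Bochner_Integration.integral_cong) auto
    then show ?thesis
      by (simp add: f_def integrable_measure_pmf_finite measure_pmf_single)
  qed
  have f1: "\<bar>f j z\<bar> \<le> 1" for j z using pmf_le_1[of "alaw t j" x] pmf_nonneg[of "alaw t j" x] by (auto simp: f_def)
  have "?E (\<lambda>Z. \<bar>\<Sum>j\<in>{1..N}. A k j * f j (Z j)\<bar>) \<le> sqrt (\<Sum>j\<in>{1..N}. (A k j)\<^sup>2)"
    by (rule expectation_Pi_pmf_abs_sum_le) (auto simp: mean f1)
  also have "\<dots> \<le> sqrt (2 * C * \<theta>)"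
  proof (rule real_sqrt_le_mono)
    have "(\<Sum>j\<in>{1..N}. (A k j)\<^sup>2) \<le> (\<Sum>j\<in>{1..N}. \<theta> * A k j)"
      unfolding power2_eq_square by (intro sum_mono mult_right_mono A_le A_nonneg)
    also have "\<dots> = \<theta> * deg k" by (simp add: deg_def sum_distrib_left)
    also have "\<dots> \<le> \<theta> * (2 * C)" using k \<theta>_pos by (intro mult_left_mono) (auto simp: Good_def Bad_def)
    finally show "(\<Sum>j\<in>{1..N}. (A k j)\<^sup>2) \<le> 2 * C * \<theta>" by (simp add: mult_ac)
  qed
  finally have lln: "?E (\<lambda>Z. \<bar>\<Sum>j\<in>{1..N}. A k j * f j (Z j)\<bar>) \<le> sqrt (2 * C * \<theta>)" .
  \<comment> \<open>Only the law of agent \<open>i\<close> can differ from the mean field, and it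
    carries weight at most \<theta>. Hence neither the deviator's index nor its policy survives in
    the bound.\<close>
  have dev: "\<bar>\<Sum>j\<in>{1..N}. A k j * (pmf (alaw t j) x - ?m j)\<bar> \<le> \<theta>" (is "\<bar>?S\<bar> \<le> \<theta>")
  proof -
    have "\<bar>?S\<bar> \<le> (\<Sum>j\<in>{1..N}. \<bar>A k j * (pmf (alaw t j) x - ?m j)\<bar>)" by (rule sum_abs)
    also have "\<dots> \<le> (\<Sum>j\<in>{1..N}. if j = i then \<theta> else 0)"
    proof (rule sum_mono)
      fix j assume j: "j \<in> {1..N}"
      show "\<bar>A k j * (pmf (alaw t j) x - ?m j)\<bar> \<le> (if j = i then \<theta> else 0)"
      proof (cases "j = i")
        case False
        then show ?thesis using agent_law_eq_mu[OF j False, of t x] by (simp add: alaw_def)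
      next
        case True
        have "\<bar>pmf (alaw t j) x - ?m j\<bar> \<le> 1"
          using pmf_le_1[of "alaw t j" x] pmf_nonneg[of "alaw t j" x] mu_nonneg[OF grid_in_unit[OF j], of t x]
            mu_le_1[OF grid_in_unit[OF j], of t x] by linarith
        then have "A k j * \<bar>pmf (alaw t j) x - ?m j\<bar> \<le> \<theta> * 1"
          using A_le A_nonneg \<theta>_pos by (intro mult_mono) auto
        then show ?thesis using True by (simp add: abs_mult A_nonneg)
      qed
    qed
    also have "\<dots> \<le> \<theta>" using \<theta>_pos by simp
    finally show ?thesis .
  qed
  have "?E (\<lambda>Z. \<bar>emp Z k x - G t k x\<bar>) \<le> ?E (\<lambda>Z. \<bar>\<Sum>j\<in>{1..N}. A k j * f j (Z j)\<bar>
      + (\<theta> + \<bar>(\<Sum>j\<in>{1..N}. A k j * ?m j) - G t k x\<bar>))"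
  proof (intro integral_mono int)
    fix Z
    have "emp Z k x - G t k x = (\<Sum>j\<in>{1..N}. A k j * f j (Z j)) + ?S + ((\<Sum>j\<in>{1..N}. A k j * ?m j) - G t k x)"
      by (simp add: emp_eq f_def right_diff_distrib sum_subtractf)
    then show "\<bar>emp Z k x - G t k x\<bar> \<le> \<bar>\<Sum>j\<in>{1..N}. A k j * f j (Z j)\<bar>
      + (\<theta> + \<bar>(\<Sum>j\<in>{1..N}. A k j * ?m j) - G t k x\<bar>)"
      using dev by linarith
  qed
  also have "\<dots> = ?E (\<lambda>Z. \<bar>\<Sum>j\<in>{1..N}. A k j * f j (Z j)\<bar>) + (\<theta> + \<bar>(\<Sum>j\<in>{1..N}. A k j * ?m j) - G t k x\<bar>)"
    by (simp add: int)
  finally show ?thesis using lln by linarith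
qed

text \<open>The game configuration is replaced by the independent copies, at a cost governed by the
  decoupled neighbours; the copies are then handled by \<open>independent_agg_error\<close>.\<close>

lemma agg_error_le:
  assumes k: "k \<in> Good" and h: "\<And>j. j \<in> Good \<Longrightarrow> decoupled t j \<le> h j"
  shows "agg_error t k \<le> agg_bound h t k"
proof -
  let ?E = "measure_pmf.expectation (coupled t)"
  have "agg_error t k \<le> ?E (\<lambda>F. 2 * (\<Sum>j\<in>{1..N}. A k j * of_bool (fst (F j) \<noteq> snd (F j)))
      + (\<Sum>x\<in>UNIV. \<bar>emp (snd \<circ> F) k x - G t k x\<bar>))"
    unfolding agg_error_def
  proof (intro integral_mono integrable_coupled)
    fix F :: "nat \<Rightarrow> 'x \<times> 'x"
    have "(\<Sum>x\<in>UNIV. \<bar>emp (fst \<circ> F) k x - G t k x\<bar>)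
        \<le> (\<Sum>x\<in>UNIV. \<bar>emp (fst \<circ> F) k x - emp (snd \<circ> F) k x\<bar> + \<bar>emp (snd \<circ> F) k x - G t k x\<bar>)"
      by (intro sum_mono) linarith
    also have "\<dots> = (\<Sum>x\<in>UNIV. \<bar>emp (fst \<circ> F) k x - emp (snd \<circ> F) k x\<bar>) + (\<Sum>x\<in>UNIV. \<bar>emp (snd \<circ> F) k x - G t k x\<bar>)"
      by (rule sum.distrib)
    also have "(\<Sum>x\<in>UNIV. \<bar>emp (fst \<circ> F) k x - emp (snd \<circ> F) k x\<bar>)
        \<le> 2 * (\<Sum>j\<in>{1..N}. A k j * of_bool (fst (F j) \<noteq> snd (F j)))"
      using emp_diff_le[of "fst \<circ> F" k "snd \<circ> F"] by simp
    finally show "(\<Sum>x\<in>UNIV. \<bar>emp (fst \<circ> F) k x - G t k x\<bar>)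
       \<le> 2 * (\<Sum>j\<in>{1..N}. A k j * of_bool (fst (F j) \<noteq> snd (F j))) + (\<Sum>x\<in>UNIV. \<bar>emp (snd \<circ> F) k x - G t k x\<bar>)"
      by (simp add: o_def)
  qed
  also have "\<dots> = 2 * (\<Sum>j\<in>{1..N}. A k j * decoupled t j) + (\<Sum>x\<in>UNIV. ?E (\<lambda>F. \<bar>emp (snd \<circ> F) k x - G t k x\<bar>))"
    unfolding decoupled_def
    by (simp add: integrable_coupled Bochner_Integration.integral_sum del: sum_mult_of_bool_eq sum_of_bool_mult_eq)
  also have "(\<Sum>j\<in>{1..N}. A k j * decoupled t j) \<le> bad_mass k + (\<Sum>j\<in>Good. A k j * h j)"
  proof -
    have "(\<Sum>j\<in>{1..N}. A k j * decoupled t j)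
        = (\<Sum>j\<in>Bad. A k j * decoupled t j) + (\<Sum>j\<in>Good. A k j * decoupled t j)"
      unfolding Good_def using sum.subset_diff[OF Bad_subset, of "\<lambda>j. A k j * decoupled t j"]
      by (simp add: add.commute)
    \<comment> \<open>For bad agents the decoupling probability is replaced by 1, which leaves
      \<open>bad_mass\<close>.\<close>
    also have "\<dots> \<le> (\<Sum>j\<in>Bad. A k j * 1) + (\<Sum>j\<in>Good. A k j * h j)"
      by (intro add_mono sum_mono mult_left_mono A_nonneg decoupled_le_1 h)
    finally show ?thesis by (simp add: bad_mass_def)
  qed
  also have "(\<Sum>x\<in>UNIV. ?E (\<lambda>F. \<bar>emp (snd \<circ> F) k x - G t k x\<bar>))
      \<le> (\<Sum>x\<in>UNIV. sqrt (2 * C * \<theta>) + \<theta> + \<bar>(\<Sum>j\<in>{1..N}. A k j * mu t (real j / real N) x) - G t k x\<bar>)"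
  proof (rule sum_mono)
    fix x
    have "?E (\<lambda>F. \<bar>emp (snd \<circ> F) k x - G t k x\<bar>)
        = measure_pmf.expectation (map_pmf (\<lambda>F. snd \<circ> F) (coupled t)) (\<lambda>Z. \<bar>emp Z k x - G t k x\<bar>)"
      by (simp add: integral_map_pmf)
    then show "?E (\<lambda>F. \<bar>emp (snd \<circ> F) k x - G t k x\<bar>)
      \<le> sqrt (2 * C * \<theta>) + \<theta> + \<bar>(\<Sum>j\<in>{1..N}. A k j * mu t (real j / real N) x) - G t k x\<bar>"
      unfolding coupled_snd using independent_agg_error[OF k] by simp
  qed
  also have "\<dots> = noise + mf_error t k"
    by (simp add: noise_def mf_error_def sum.distrib distrib_left)
  finally show ?thesis by (simp add: agg_bound_def algebra_simps)
qed

lemma decoupled_le: "k \<in> Good \<Longrightarrow> decoupled t k \<le> decoupled_bound t k"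
proof (induction t arbitrary: k)
  case 0
  then show ?case by (simp add: decoupled_0 Good_def)
next
  case (Suc t)
  have "decoupled (Suc t) k \<le> decoupled t k + LP * agg_error t k"
    by (rule decoupled_Suc) (use Suc.prems in \<open>auto simp: Good_def\<close>)
  also have "\<dots> \<le> decoupled_bound t k + LP * agg_bound (decoupled_bound t) t k"
    by (intro add_mono mult_left_mono Suc.IH agg_error_le LP_nonneg Suc.prems)
  finally show ?case by simp
qed

lemma return_close:
  assumes k: "k \<in> Good"
  shows "\<bar>game_return P r mu0 E rhoN N T pis k - mf_return P r mu0 W T mu (real k / real N) (pis k)\<bar>
    \<le> (\<Sum>t<T. 2 * M * decoupled_bound t k + Lr * agg_bound (decoupled_bound t) t k)"
proof -
  have kN: "k \<in> {1..N}" using k by (simp add: Good_def)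
  have M0: "M \<ge> 0" using r_bound[OF grid_in_unit[OF kN]] abs_ge_zero order_trans by blast
  let ?E = "\<lambda>t. measure_pmf.expectation (coupled t)"
  have game: "measure_pmf.expectation (joint_law P mu0 E rhoN N pis t)
        (\<lambda>X. measure_pmf.expectation (pis k t (X k)) (\<lambda>u. r (X k) u (emp_nbhd E rhoN N X k)))
     = ?E t (\<lambda>F. measure_pmf.expectation (pis k t (fst (F k))) (\<lambda>u. r (fst (F k)) u (emp (fst \<circ> F) k)))" for t
    by (simp add: emp_def integral_map_pmf flip: coupled_fst)
  have "agent_law P mu0 W mu (real k / real N) (pis k) t = map_pmf (\<lambda>F. snd (F k)) (coupled t)" for t
  proof -
    have "map_pmf (\<lambda>F. snd (F k)) (coupled t) = map_pmf (\<lambda>Z. Z k) (map_pmf (\<lambda>F. snd \<circ> F) (coupled t))"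
      by (simp add: pmf.map_comp o_def)
    then show ?thesis unfolding coupled_snd using kN by (simp add: Pi_pmf_component alaw_def)
  qed
  then have mf: "measure_pmf.expectation (agent_law P mu0 W mu (real k / real N) (pis k) t)
        (\<lambda>x. measure_pmf.expectation (pis k t x) (\<lambda>u. r x u (graphon_agg W (mu t) (real k / real N))))
     = ?E t (\<lambda>F. measure_pmf.expectation (pis k t (snd (F k))) (\<lambda>u. r (snd (F k)) u (G t k)))" for t
    by (simp add: integral_map_pmf G_def)
  have step: "\<bar>?E t (\<lambda>F. measure_pmf.expectation (pis k t (fst (F k))) (\<lambda>u. r (fst (F k)) u (emp (fst \<circ> F) k)))
       - ?E t (\<lambda>F. measure_pmf.expectation (pis k t (snd (F k))) (\<lambda>u. r (snd (F k)) u (G t k)))\<bar>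
      \<le> 2 * M * decoupled_bound t k + Lr * agg_bound (decoupled_bound t) t k" for t
  proof -
    define R where "R x g = measure_pmf.expectation (pis k t x) (\<lambda>u. r x u g)" for x g
    have R_G: "\<bar>R x (G t k)\<bar> \<le> M" for x
    proof -
      have "\<bar>R x (G t k)\<bar> \<le> measure_pmf.expectation (pis k t x) (\<lambda>u. \<bar>r x u (G t k)\<bar>)"
        unfolding R_def by (rule integral_abs_bound)
      also have "\<dots> \<le> measure_pmf.expectation (pis k t x) (\<lambda>u. M)"
        by (intro integral_mono integrable_measure_pmf_finite finite)
           (simp add: G_def r_bound[OF grid_in_unit[OF kN]])
      finally show ?thesis by simp
    qed
    have R_lip: "\<bar>R x (emp X k) - R x (G t k)\<bar> \<le> Lr * (\<Sum>y\<in>UNIV. \<bar>emp X k y - G t k y\<bar>)" for x X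
    proof -
      have "\<bar>R x (emp X k) - R x (G t k)\<bar> = \<bar>measure_pmf.expectation (pis k t x) (\<lambda>u. r x u (emp X k) - r x u (G t k))\<bar>"
        unfolding R_def by (simp add: integrable_measure_pmf_finite)
      also have "\<dots> \<le> measure_pmf.expectation (pis k t x) (\<lambda>u. \<bar>r x u (emp X k) - r x u (G t k)\<bar>)"
        by (rule integral_abs_bound)
      also have "\<dots> \<le> measure_pmf.expectation (pis k t x) (\<lambda>u. Lr * (\<Sum>y\<in>UNIV. \<bar>emp X k y - G t k y\<bar>))"
        by (intro integral_mono integrable_measure_pmf_finite finite r_lipschitz)
           (use kN in \<open>auto intro: emp_nonneg G_nonneg\<close>)
      finally show ?thesis by simp
    qed
    have "\<bar>?E t (\<lambda>F. R (fst (F k)) (emp (fst \<circ> F) k)) - ?E t (\<lambda>F. R (snd (F k)) (G t k))\<bar>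
        = \<bar>?E t (\<lambda>F. R (fst (F k)) (emp (fst \<circ> F) k) - R (snd (F k)) (G t k))\<bar>"
      by (simp add: integrable_coupled)
    also have "\<dots> \<le> ?E t (\<lambda>F. \<bar>R (fst (F k)) (emp (fst \<circ> F) k) - R (snd (F k)) (G t k)\<bar>)"
      by (rule integral_abs_bound)
    also have "\<dots> \<le> ?E t (\<lambda>F. 2 * M * of_bool (fst (F k) \<noteq> snd (F k))
        + Lr * (\<Sum>y\<in>UNIV. \<bar>emp (fst \<circ> F) k y - G t k y\<bar>))"
    proof (intro integral_mono integrable_coupled)
      fix F :: "nat \<Rightarrow> 'x \<times> 'x"
      \<comment> \<open>The comparison passes through the game state paired with the limiting
        aggregate, because \<open>M\<close> bounds the reward only at limiting aggregates.\<close>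
      have "\<bar>R (fst (F k)) (G t k) - R (snd (F k)) (G t k)\<bar> \<le> 2 * M * of_bool (fst (F k) \<noteq> snd (F k))"
        using R_G[of "fst (F k)"] R_G[of "snd (F k)"] M0 by auto
      with R_lip[of "fst (F k)" "fst \<circ> F"]
      show "\<bar>R (fst (F k)) (emp (fst \<circ> F) k) - R (snd (F k)) (G t k)\<bar>
        \<le> 2 * M * of_bool (fst (F k) \<noteq> snd (F k)) + Lr * (\<Sum>y\<in>UNIV. \<bar>emp (fst \<circ> F) k y - G t k y\<bar>)"
        by linarith
    qed
    also have "\<dots> = 2 * M * decoupled t k + Lr * agg_error t k"
      unfolding decoupled_def agg_error_def by (simp add: integrable_coupled)
    also have "\<dots> \<le> 2 * M * decoupled_bound t k + Lr * agg_bound (decoupled_bound t) t k"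
      by (intro add_mono mult_left_mono decoupled_le agg_error_le Lr_nonneg k) (use M0 in auto)
    finally show ?thesis unfolding R_def .
  qed
  have "\<bar>game_return P r mu0 E rhoN N T pis k - mf_return P r mu0 W T mu (real k / real N) (pis k)\<bar>
     = \<bar>\<Sum>t<T. ?E t (\<lambda>F. measure_pmf.expectation (pis k t (fst (F k))) (\<lambda>u. r (fst (F k)) u (emp (fst \<circ> F) k)))
       - ?E t (\<lambda>F. measure_pmf.expectation (pis k t (snd (F k))) (\<lambda>u. r (snd (F k)) u (G t k)))\<bar>"
    unfolding game_return_def mf_return_def game mf sum_subtractf ..
  also have "\<dots> \<le> (\<Sum>t<T. 2 * M * decoupled_bound t k + Lr * agg_bound (decoupled_bound t) t k)"
    by (rule order_trans[OF sum_abs]) (intro sum_mono step)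
  finally show ?thesis .
qed

end

section \<open>Limits and uniform error bounds\<close>

lemma inverse_scaled_density_tendsto_0:
  assumes W: "regular_graphon W C L D"
    and E_sym: "\<And>N i j. E N i j \<Longrightarrow> E N j i" and rho_pos: "\<And>N. rho N > 0"
    and rho_Theta: "rho \<in> \<Theta>(\<lambda>N. real (num_edges (E N) N) / real N ^ 2)"
    and A1: "(\<lambda>N. linf_l1_norm (\<lambda>x y. step_graphon (E N) N x y / rho N - W x y)) \<longlonglongrightarrow> 0"
  shows "(\<lambda>N. 1 / (real N * rho N)) \<longlonglongrightarrow> 0"
proof -
  interpret regular_graphon W C L D by (rule W)
  define d where "d N = linf_l1_norm (\<lambda>x y. step_graphon (E N) N x y / rho N - W x y)" for N
  define f where "f N = real (card {k \<in> {1..N}. \<exists>j\<in>{1..N}. E N k j}) / real N" for N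
  have g: "graph_near_graphon W C L D (E N) N (rho N)" if "N > 0" for N
    using that E_sym rho_pos by unfold_locales auto
  have edge: "real (num_edges (E N) N) / real N ^ 2 / rho N \<le> d N + C * f N"
    and theta: "1 / (real N * rho N) * f N \<le> d N + C / sqrt (real N)" if "N > 0" for N
  proof -
    interpret g: graph_near_graphon W C L D "E N" N "rho N" by (rule g[OF that])
    show "real (num_edges (E N) N) / real N ^ 2 / rho N \<le> d N + C * f N"
      using g.edge_density_le unfolding g.\<delta>_def g.NonIsolated_def d_def f_def .
    show "1 / (real N * rho N) * f N \<le> d N + C / sqrt (real N)"
      using g.\<theta>_mult_nonisolated_le unfolding g.\<delta>_def g.\<theta>_def g.NonIsolated_def d_def f_def .
  qed
  from bigthetaD1[OF rho_Theta] obtain c where c: "c > 0"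
    "\<forall>\<^sub>F N in sequentially. norm (rho N) \<le> c * norm (real (num_edges (E N) N) / real N ^ 2)"
    by (elim landau_o.bigE)
  \<comment> \<open>Eventually \<open>rho N\<close> is at most \<open>c\<close> times the edge
    density. Once also \<open>d N < 1 / (2 * c)\<close>, the bound \<open>edge\<close> leaves
    \<open>C * f N \<ge> 1 / (2 * c)\<close>, so \<open>f0\<close> bounds the fraction of
    non-isolated vertices from below.\<close>
  define f0 where "f0 = 1 / (2 * c * C)"
  have f0: "f0 > 0" using c(1) C_pos by (simp add: f0_def)
  have d0: "d \<longlonglongrightarrow> 0" using A1 unfolding d_def[abs_def] .
  have ev: "\<forall>\<^sub>F N in sequentially. 1 / (real N * rho N) \<le> (d N + C / sqrt (real N)) / f0"
  proof -
    have "\<forall>\<^sub>F N in sequentially. d N < 1 / (2 * c)"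
      using order_tendstoD(2)[OF d0, of "1 / (2 * c)"] c(1) by simp
    then show ?thesis using c(2) eventually_gt_at_top[of 0]
    proof eventually_elim
      case (elim N)
      have "1 / c \<le> e / rho N" if "rho N \<le> c * e" for e
        using that rho_pos[of N] c(1) by (simp add: field_simps)
      moreover have "rho N \<le> c * (real (num_edges (E N) N) / real N ^ 2)"
        using elim(2) rho_pos[of N] by simp
      ultimately have "1 / c \<le> real (num_edges (E N) N) / real N ^ 2 / rho N" .
      also note edge[OF elim(3)]
      finally have "1 / (2 * c) \<le> C * f N" using elim(1) c(1) by (simp add: field_simps)
      then have "f0 \<le> f N" using C_pos c(1) by (simp add: f0_def field_simps)
      then have "1 / (real N * rho N) * f0 \<le> 1 / (real N * rho N) * f N"
        using rho_pos[of N] by (intro mult_left_mono) auto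
      also note theta[OF elim(3)]
      finally show ?case by (subst pos_le_divide_eq[OF f0])
    qed
  qed
  have "(\<lambda>N. (d N + C / sqrt (real N)) / f0) \<longlonglongrightarrow> (0 + 0) / f0"
  proof (intro tendsto_intros d0)
    show "(\<lambda>N. C / sqrt (real N)) \<longlonglongrightarrow> 0"
      by (intro tendsto_divide_0[OF tendsto_const] filterlim_at_top_imp_at_infinity
          filterlim_compose[OF sqrt_at_top filterlim_real_sequentially])
  qed (use f0 in auto)
  then have lim: "(\<lambda>N. (d N + C / sqrt (real N)) / f0) \<longlonglongrightarrow> 0" by simp
  show ?thesis
    by (rule tendsto_sandwich[OF _ ev tendsto_const lim]) (use rho_pos in \<open>auto intro!: always_eventually simp: less_imp_le\<close>)
qed

section \<open>The mean field flow and its regularity\<close>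

lemma graphon_agg_cong:
  "(\<And>b. b \<in> {0..1} \<Longrightarrow> m b = m' b) \<Longrightarrow> graphon_agg W m = graphon_agg W m'"
  unfolding graphon_agg_def by (intro ext set_lebesgue_integral_cong) auto

text \<open>An agent that plays the policy of its own index has the mean field as its law; this
  identifies the independent copies of all agents that do not deviate.\<close>

lemma agent_law_eq_mf_flow:
  assumes "\<And>t b. b \<in> {0..1} \<Longrightarrow> mu t b = mf_flow P mu0 W \<pi>e t b"
  shows "pmf (agent_law P mu0 W mu a (\<pi>e a) t) x = mf_flow P mu0 W \<pi>e t a x"
proof (induction t arbitrary: x)
  case (Suc t)
  have exp: "measure_pmf.expectation p f = (\<Sum>y\<in>UNIV. pmf p y * f y)" for p :: "'c::finite pmf" and f :: "'c \<Rightarrow> real"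
    by (subst integral_measure_pmf_real[of UNIV]) (auto simp: mult.commute)
  have "graphon_agg W (mu t) = graphon_agg W (mf_flow P mu0 W \<pi>e t)"
    by (rule graphon_agg_cong) (rule assms)
  then show ?case by (simp add: pmf_bind exp Suc)
qed simp

text \<open>With the flow itself taken as the mean field, the preceding identity exhibits it as the
  mass function of a distribution.\<close>

lemma mf_flow_bounds:
  shows "0 \<le> mf_flow P mu0 W \<pi>e t a x" and "mf_flow P mu0 W \<pi>e t a x \<le> 1"
  using agent_law_eq_mf_flow[of "mf_flow P mu0 W \<pi>e" P mu0 W \<pi>e a t x]
  by (metis pmf_nonneg, metis pmf_le_1)

text \<open>Induction on time: the aggregate is regular through the smoothing by \<open>W\<close>,
  the kernel inherits this by its Lipschitz bound, the policy has it by hypothesis, and sums and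
  products preserve it.\<close>

lemma (in regular_graphon) continuous_except_finite_mf_flow:
  fixes P :: "'x::finite \<Rightarrow> 'u::finite \<Rightarrow> ('x \<Rightarrow> real) \<Rightarrow> 'x pmf"
  assumes P: "\<And>x u g g'. (\<forall>y. 0 \<le> g y) \<Longrightarrow> (\<forall>y. 0 \<le> g' y) \<Longrightarrow>
      (\<Sum>z\<in>UNIV. \<bar>pmf (P x u g) z - pmf (P x u g') z\<bar>) \<le> LP * (\<Sum>y\<in>UNIV. \<bar>g y - g' y\<bar>)"
    and \<pi>e: "\<And>t x u. lipschitz_except_finite (\<lambda>a. pmf (\<pi>e a t x) u)"
  shows "continuous_except_finite (\<lambda>a. mf_flow P mu0 W \<pi>e t a x)"
proof (induction t arbitrary: x)
  case 0
  show ?case by (simp add: continuous_except_finite_const)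
next
  case (Suc t)
  let ?m = "mf_flow P mu0 W \<pi>e t"
  have m_abs: "\<bar>?m a y\<bar> \<le> 1" for a y
    using mf_flow_bounds[of P mu0 W \<pi>e t a y] by simp
  have agg: "continuous_except_finite (\<lambda>a. graphon_agg W ?m a y)" for y
    unfolding graphon_agg_eq_wint
    by (rule continuous_except_finite_wint[OF continuous_except_finite_measurable[OF Suc] m_abs])
  have agg0: "0 \<le> graphon_agg W ?m a y" if "a \<in> {0..1}" for a y
    unfolding graphon_agg_eq_wint by (rule wint_nonneg[OF mf_flow_bounds(1) that])
  have "continuous_except_finite (\<lambda>a. pmf (P x' u (graphon_agg W ?m a)) x)" for x' u
  proof (rule continuous_except_finite_modulus[where I = UNIV and g = "\<lambda>y a. graphon_agg W ?m a y", OF finite agg])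
    fix a b :: real assume ab: "a \<in> {0..1}" "b \<in> {0..1}"
    have "\<bar>pmf (P x' u (graphon_agg W ?m a)) x - pmf (P x' u (graphon_agg W ?m b)) x\<bar>
        \<le> (\<Sum>z\<in>UNIV. \<bar>pmf (P x' u (graphon_agg W ?m a)) z - pmf (P x' u (graphon_agg W ?m b)) z\<bar>)"
      by (rule member_le_sum[of x UNIV "\<lambda>z. \<bar>pmf (P x' u (graphon_agg W ?m a)) z - pmf (P x' u (graphon_agg W ?m b)) z\<bar>"]) auto
    also have "\<dots> \<le> LP * (\<Sum>y\<in>UNIV. \<bar>graphon_agg W ?m a y - graphon_agg W ?m b y\<bar>)"
      by (rule P) (use agg0 ab in auto)
    finally show "\<bar>pmf (P x' u (graphon_agg W ?m a)) x - pmf (P x' u (graphon_agg W ?m b)) x\<bar>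
        \<le> LP * (\<Sum>y\<in>UNIV. \<bar>graphon_agg W ?m a y - graphon_agg W ?m b y\<bar>)" .
  qed
  then show ?case
    by (simp, intro continuous_except_finite_sum continuous_except_finite_mult Suc
        lipschitz_except_finite_imp_continuous[OF \<pi>e]) auto
qed

text \<open>Constants of a discrete Gronwall argument: \<open>4 * C\<close> is the factor in
  \<open>sum_agg_bound_le\<close> and 1 stands for the error of the current step. They do not depend
  on the graph or on \<open>N\<close>.\<close>

primrec growth :: "real \<Rightarrow> real \<Rightarrow> nat \<Rightarrow> real" where
  "growth C LP 0 = 0"
| "growth C LP (Suc t) = growth C LP t + LP * (4 * C * growth C LP t + 1)"

section \<open>Averaging the error recursion over the good agents\<close>

context graph_game
begin

definition step_error :: "nat \<Rightarrow> real" where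
  "step_error t = 4 * \<delta> + (\<Sum>k\<in>{1..N}. mf_error t k) / real N + noise"

lemma average_bounds:
  assumes e: "\<And>t. t < T \<Longrightarrow> step_error t \<le> e"
  shows "t \<le> T \<Longrightarrow> (\<Sum>k\<in>Good. decoupled_bound t k) / real N \<le> growth C LP t * e"
    and "t < T \<Longrightarrow> (\<Sum>k\<in>Good. agg_bound (decoupled_bound t) t k) / real N \<le> (4 * C * growth C LP t + 1) * e"
proof -
  have agg: "(\<Sum>k\<in>Good. agg_bound (decoupled_bound t) t k) / real N \<le> (4 * C * growth C LP t + 1) * e"
    if "t < T" "(\<Sum>k\<in>Good. decoupled_bound t k) / real N \<le> growth C LP t * e" for t
  proof -
    have "(\<Sum>k\<in>Good. agg_bound (decoupled_bound t) t k) / real N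
        \<le> 4 * C * ((\<Sum>k\<in>Good. decoupled_bound t k) / real N) + step_error t"
      using sum_agg_bound_le[of "decoupled_bound t" t, OF decoupled_bound_nonneg] by (simp add: step_error_def)
    also have "\<dots> \<le> 4 * C * (growth C LP t * e) + e"
      using that e C_pos by (intro add_mono mult_left_mono) auto
    finally show ?thesis by (simp add: algebra_simps)
  qed
  have dec: "t \<le> T \<Longrightarrow> (\<Sum>k\<in>Good. decoupled_bound t k) / real N \<le> growth C LP t * e" for t
  proof (induction t)
    case (Suc t)
    have "(\<Sum>k\<in>Good. decoupled_bound (Suc t) k) / real N
        = (\<Sum>k\<in>Good. decoupled_bound t k) / real N + LP * ((\<Sum>k\<in>Good. agg_bound (decoupled_bound t) t k) / real N)"
      by (simp add: sum.distrib add_divide_distrib flip: sum_distrib_left)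
    also have "\<dots> \<le> growth C LP t * e + LP * ((4 * C * growth C LP t + 1) * e)"
      using Suc by (intro add_mono mult_left_mono LP_nonneg agg) auto
    finally show ?case by (simp add: algebra_simps)
  qed simp
  then show "t \<le> T \<Longrightarrow> (\<Sum>k\<in>Good. decoupled_bound t k) / real N \<le> growth C LP t * e" .
  show "t < T \<Longrightarrow> (\<Sum>k\<in>Good. agg_bound (decoupled_bound t) t k) / real N \<le> (4 * C * growth C LP t + 1) * e"
    by (intro agg dec) auto
qed

definition return_bound :: "nat \<Rightarrow> nat \<Rightarrow> real" where
  "return_bound T k = (\<Sum>t<T. 2 * M * decoupled_bound t k + Lr * agg_bound (decoupled_bound t) t k)"

lemma M_nonneg: "0 \<le> M"
  by (rule order_trans[OF abs_ge_zero r_bound[of 0]]) simp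

text \<open>Markov's inequality for \<open>return_bound\<close> over the good agents; the bad ones
  are absent from that average and account for the term \<open>\<delta> / C\<close>.\<close>

lemma card_large_return_bound:
  assumes e: "\<And>t. t < T \<Longrightarrow> step_error t \<le> e" and \<eta>: "\<eta> > 0"
  shows "real (card {k \<in> Good. return_bound T k \<le> \<eta>})
    \<ge> real N - (\<delta> / C + (\<Sum>t<T. 2 * M * growth C LP t + Lr * (4 * C * growth C LP t + 1)) * e / \<eta>) * real N"
proof -
  let ?K = "\<Sum>t<T. 2 * M * growth C LP t + Lr * (4 * C * growth C LP t + 1)"
  let ?X = "{k \<in> Good. return_bound T k \<le> \<eta>}" and ?Y = "{k \<in> Good. return_bound T k > \<eta>}"
  have fin: "finite Good" by (simp add: Good_def)
  have rb0: "0 \<le> return_bound T k" for k unfolding return_bound_def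
    by (intro sum_nonneg add_nonneg_nonneg mult_nonneg_nonneg decoupled_bound_nonneg agg_bound_nonneg
        M_nonneg Lr_nonneg) auto
  have "real (card ?Y) * \<eta> = (\<Sum>k\<in>?Y. \<eta>)" by simp
  also have "\<dots> \<le> (\<Sum>k\<in>?Y. return_bound T k)" by (intro sum_mono) auto
  also have "\<dots> \<le> (\<Sum>k\<in>Good. return_bound T k)"
    by (intro sum_mono2) (use fin rb0 in auto)
  also have "\<dots> = (\<Sum>t<T. 2 * M * ((\<Sum>k\<in>Good. decoupled_bound t k) / real N)
      + Lr * ((\<Sum>k\<in>Good. agg_bound (decoupled_bound t) t k) / real N)) * real N"
    unfolding return_bound_def using N_pos
    by (subst sum.swap) (simp add: sum_distrib_right sum_distrib_left sum_divide_distrib sum.distrib distrib_right)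
  also have "\<dots> \<le> (\<Sum>t<T. 2 * M * (growth C LP t * e) + Lr * ((4 * C * growth C LP t + 1) * e)) * real N"
    by (intro mult_right_mono sum_mono add_mono mult_left_mono average_bounds[OF e])
       (use M_nonneg Lr_nonneg in auto)
  also have "(\<Sum>t<T. 2 * M * (growth C LP t * e) + Lr * ((4 * C * growth C LP t + 1) * e)) = ?K * e"
    unfolding sum_distrib_right by (rule sum.cong) (auto simp: algebra_simps)
  finally have Y: "real (card ?Y) \<le> ?K * e / \<eta> * real N" using \<eta> by (simp add: field_simps)
  have "{1..N} = ?X \<union> ?Y \<union> Bad" using Bad_subset by (auto simp: Good_def)
  then have "N = card (?X \<union> ?Y \<union> Bad)" by (metis card_atLeastAtMost diff_Suc_1)
  also have "\<dots> \<le> card ?X + card ?Y + card Bad"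
    by (meson add_right_mono card_Un_le order_trans)
  finally have "real N \<le> real (card ?X) + real (card ?Y) + real (card Bad)" by linarith
  with Y card_Bad show ?thesis by (simp add: distrib_right)
qed

end

theorem theorem3:
  fixes P :: "'x::finite \<Rightarrow> 'u::finite \<Rightarrow> ('x \<Rightarrow> real) \<Rightarrow> 'x pmf"
    and r :: "'x \<Rightarrow> 'u \<Rightarrow> ('x \<Rightarrow> real) \<Rightarrow> real"
    and mu0 :: "'x pmf"
    and W :: "real \<Rightarrow> real \<Rightarrow> real"
    and T :: nat
    and E :: "nat \<Rightarrow> nat \<Rightarrow> nat \<Rightarrow> bool"
    and rho :: "nat \<Rightarrow> real"
    and \<pi>e :: "real \<Rightarrow> nat \<Rightarrow> 'x \<Rightarrow> 'u pmf"
    and mu :: "nat \<Rightarrow> real \<Rightarrow> 'x \<Rightarrow> real"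
  assumes graphon: "is_graphon W"
    and graph_vertices: "\<And>N i j. E N i j \<Longrightarrow> i \<in> {1..N} \<and> j \<in> {1..N}"
    and graph_sym: "\<And>N i j. E N i j \<Longrightarrow> E N j i"
    and graph_irrefl: "\<And>N i. \<not> E N i i"
    and rho_pos: "\<And>N. rho N > 0"
    and rho_Theta: "rho \<in> \<Theta>(\<lambda>N. real (num_edges (E N) N) / real N ^ 2)"
    and A1_cut: "(\<lambda>N. cut_norm (\<lambda>x y. step_graphon (E N) N x y / rho N - W x y)) \<longlonglongrightarrow> 0"
    and A1_op: "(\<lambda>N. linf_l1_norm (\<lambda>x y. step_graphon (E N) N x y / rho N - W x y)) \<longlonglongrightarrow> 0"
    and A2_r: "reward_lipschitz r"
    and A2_P: "kernel_lipschitz P"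
    and A2_W: "graphon_piecewise_lipschitz W"
    and ensemble: "policy_ensemble \<pi>e"
    and gmfe: "is_GMFE P r mu0 W T \<pi>e mu"
    and pi_lip: "\<And>t x u. lipschitz_except_finite (\<lambda>\<alpha>. pmf (\<pi>e \<alpha> t x) u)"
  shows "\<forall>\<epsilon>>0. \<forall>p>0. \<exists>N'. \<forall>N>N'.
           markov_nash P r mu0 (E N) (rho N) N T \<epsilon> p (Gamma_N N \<pi>e)"
proof (intro allI impI)
  fix \<epsilon> p :: real assume \<epsilon>: "\<epsilon> > 0" and p: "p > 0"
  obtain C L D where W: "regular_graphon W C L D"
    using is_graphon_imp_regular[OF graphon A2_W] by blast
  interpret regular_graphon W C L D by (rule W)
  obtain LP where LP: "LP \<ge> 0" and P_lip: "\<And>x u g g'. (\<forall>y. 0 \<le> g y) \<Longrightarrow> (\<forall>y. 0 \<le> g' y) \<Longrightarrow>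
      (\<Sum>z\<in>UNIV. \<bar>pmf (P x u g) z - pmf (P x u g') z\<bar>) \<le> LP * (\<Sum>y\<in>UNIV. \<bar>g y - g' y\<bar>)"
  proof -
    from A2_P obtain l where l: "\<And>x u g g'. (\<forall>y. 0 \<le> g y) \<Longrightarrow> (\<forall>y. 0 \<le> g' y) \<Longrightarrow>
      (\<Sum>z\<in>UNIV. \<bar>pmf (P x u g) z - pmf (P x u g') z\<bar>) \<le> l * (\<Sum>y\<in>UNIV. \<bar>g y - g' y\<bar>)"
      unfolding kernel_lipschitz_def by blast
    \<comment> \<open>The definition does not make the Lipschitz constant nonnegative, so it is
      replaced by its modulus.\<close>
    have "l * (\<Sum>y\<in>UNIV. \<bar>g y - g' y\<bar>) \<le> \<bar>l\<bar> * (\<Sum>y\<in>UNIV. \<bar>g y - g' y\<bar>)" for g g' :: "'x \<Rightarrow> real"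
      by (intro mult_right_mono sum_nonneg) auto
    from order_trans[OF l this] show ?thesis by (intro that[of "\<bar>l\<bar>"]) simp_all
  qed
  obtain Lr where Lr: "Lr \<ge> 0" and r_lip: "\<And>x u g g'. (\<forall>y. 0 \<le> g y) \<Longrightarrow> (\<forall>y. 0 \<le> g' y) \<Longrightarrow>
      \<bar>r x u g - r x u g'\<bar> \<le> Lr * (\<Sum>y\<in>UNIV. \<bar>g y - g' y\<bar>)"
  proof -
    from A2_r obtain l where l: "\<And>x u g g'. (\<forall>y. 0 \<le> g y) \<Longrightarrow> (\<forall>y. 0 \<le> g' y) \<Longrightarrow>
      \<bar>r x u g - r x u g'\<bar> \<le> l * (\<Sum>y\<in>UNIV. \<bar>g y - g' y\<bar>)"
      unfolding reward_lipschitz_def by blast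
    have "l * (\<Sum>y\<in>UNIV. \<bar>g y - g' y\<bar>) \<le> \<bar>l\<bar> * (\<Sum>y\<in>UNIV. \<bar>g y - g' y\<bar>)" for g g' :: "'x \<Rightarrow> real"
      by (intro mult_right_mono sum_nonneg) auto
    from order_trans[OF l this] show ?thesis by (intro that[of "\<bar>l\<bar>"]) simp_all
  qed
  have mu: "mu t a = mf_flow P mu0 W \<pi>e t a" if "a \<in> {0..1}" for t a
    using gmfe that unfolding is_GMFE_def by blast
  have mu_nonneg: "0 \<le> mu t a x" and mu_le_1: "mu t a x \<le> 1" if "a \<in> {0..1}" for t a x
    using mf_flow_bounds[of P mu0 W \<pi>e t a x] mu[OF that] by auto
  have mu_abs: "\<bar>mu t a x\<bar> \<le> 1" if "a \<in> {0..1}" for t a x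
    using mu_nonneg[OF that] mu_le_1[OF that] by simp
  \<comment> \<open>\<open>mu\<close> is known to agree with the flow only on the unit interval; the
    modulus criterion with a single index transfers the continuity.\<close>
  have mu_cont: "continuous_except_finite (\<lambda>a. mu t a x)" for t x
    by (rule continuous_except_finite_modulus[where I = "{()}" and L = 1
          and g = "\<lambda>_ a. mf_flow P mu0 W \<pi>e t a x"])
       (auto simp: mu intro!: continuous_except_finite_mf_flow[where LP = LP] P_lip pi_lip)
  have agg_abs: "\<bar>graphon_agg W (mu t) a y\<bar> \<le> C" if "a \<in> {0..1}" for t a y
    unfolding graphon_agg_eq_wint using wint_abs_le[of "\<lambda>b. mu t b y" 1 a] mu_abs that by simp
  have agg_nonneg: "0 \<le> graphon_agg W (mu t) a y" if "a \<in> {0..1}" for t a y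
    unfolding graphon_agg_eq_wint using mu_nonneg that by (intro wint_nonneg) auto
  \<comment> \<open>The size of the reward at the zero measure plus its variation up to an aggregate
    with entries at most \<open>C\<close>.\<close>
  define M where "M = (\<Sum>x\<in>UNIV. \<Sum>u\<in>UNIV. \<bar>r x u (\<lambda>_. 0)\<bar>) + Lr * (real CARD('x) * C)"
  have r_bound: "\<bar>r x u (graphon_agg W (mu t) a)\<bar> \<le> M" if a: "a \<in> {0..1}" for x u t a
  proof -
    have "\<bar>r x u (graphon_agg W (mu t) a) - r x u (\<lambda>_. 0)\<bar> \<le> Lr * (\<Sum>y\<in>UNIV. \<bar>graphon_agg W (mu t) a y - 0\<bar>)"
      by (rule r_lip) (use agg_nonneg[OF a] in auto)
    also have "\<dots> \<le> Lr * (\<Sum>y\<in>(UNIV :: 'x set). C)"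
      using agg_abs[OF a] by (intro mult_left_mono sum_mono Lr) auto
    finally have "\<bar>r x u (graphon_agg W (mu t) a) - r x u (\<lambda>_. 0)\<bar> \<le> Lr * (real CARD('x) * C)" by simp
    moreover have "\<bar>r x u (\<lambda>_. 0)\<bar> \<le> (\<Sum>u\<in>UNIV. \<bar>r x u (\<lambda>_. 0)\<bar>)"
      by (rule member_le_sum[of u UNIV "\<lambda>u. \<bar>r x u (\<lambda>_. 0)\<bar>"]) auto
    moreover have "(\<Sum>u\<in>UNIV. \<bar>r x u (\<lambda>_. 0)\<bar>) \<le> (\<Sum>x\<in>UNIV. \<Sum>u\<in>UNIV. \<bar>r x u (\<lambda>_. 0)\<bar>)"
      by (rule member_le_sum[of x UNIV "\<lambda>x. \<Sum>u\<in>UNIV. \<bar>r x u (\<lambda>_. 0)\<bar>"]) (auto intro!: sum_nonneg)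
    ultimately show ?thesis unfolding M_def by linarith
  qed
  have game: "graph_game W C L D (E N) N (rho N) P r mu LP Lr M" if "N > 0" for N
    using that rho_pos graph_sym LP Lr P_lip r_lip mu_nonneg mu_le_1 r_bound by unfold_locales auto

  define d where "d N = linf_l1_norm (\<lambda>x y. step_graphon (E N) N x y / rho N - W x y)" for N
  define th where "th N = 1 / (real N * rho N)" for N
  define I where "I t x N = set_lebesgue_integral lborel {0..1} (\<lambda>a. \<bar>mu t (real (cell N a) / real N) x - mu t a x\<bar>)" for t x N
  define J where "J t x N = set_lebesgue_integral lborel {0..1}
    (\<lambda>a. \<bar>wint (\<lambda>b. mu t b x) (real (cell N a) / real N) - wint (\<lambda>b. mu t b x) a\<bar>)" for t x N
  \<comment> \<open>Dominates \<open>step_error t\<close> for all \<open>t < T\<close> at once: the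
    mean field errors are summed over time, and each summand is nonnegative.\<close>
  define e where "e N = 4 * d N + (\<Sum>t<T. \<Sum>x\<in>UNIV. d N + C * I t x N + J t x N)
      + real CARD('x) * (sqrt (2 * C * th N) + th N)" for N
  have d0: "d \<longlonglongrightarrow> 0" using A1_op unfolding d_def[abs_def] .
  have th0: "th \<longlonglongrightarrow> 0"
    using inverse_scaled_density_tendsto_0[OF W graph_sym rho_pos rho_Theta A1_op] unfolding th_def[abs_def] .
  have I0: "I t x \<longlonglongrightarrow> 0" for t x
    unfolding I_def[abs_def] by (rule cell_discretization_tendsto_0[OF mu_cont mu_abs])
  have J0: "J t x \<longlonglongrightarrow> 0" for t x
    unfolding J_def[abs_def]
    by (rule cell_discretization_tendsto_0[OF continuous_except_finite_wint[OF
            continuous_except_finite_measurable[OF mu_cont] mu_abs] wint_abs_le[OF mu_abs]])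
  have e0: "e \<longlonglongrightarrow> 0"
  proof -
    have "e \<longlonglongrightarrow> 4 * 0 + (\<Sum>t<T. \<Sum>x\<in>(UNIV :: 'x set). 0 + C * 0 + 0) + real CARD('x) * (sqrt (2 * C * 0) + 0)"
      unfolding e_def[abs_def] by (intro tendsto_intros d0 I0 J0 th0)
    then show ?thesis by simp
  qed
  define K where "K = (\<Sum>t<T. 2 * M * growth C LP t + Lr * (4 * C * growth C LP t + 1))"
  \<comment> \<open>The first term bounds the fraction of bad agents, the second the fraction of
    good ones whose return error may exceed \<open>\<epsilon> / 2\<close>.\<close>
  have "(\<lambda>N. d N / C + K * e N / (\<epsilon> / 2)) \<longlonglongrightarrow> 0 / C + K * 0 / (\<epsilon> / 2)"
    using C_pos \<epsilon> by (intro tendsto_intros d0 e0) auto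
  then have "\<forall>\<^sub>F N in sequentially. d N / C + K * e N / (\<epsilon> / 2) < p"
    using p by (intro order_tendstoD) auto
  then obtain N0 where N0: "\<And>N. N \<ge> N0 \<Longrightarrow> d N / C + K * e N / (\<epsilon> / 2) < p"
    unfolding eventually_sequentially by blast

  show "\<exists>N'. \<forall>N>N'. markov_nash P r mu0 (E N) (rho N) N T \<epsilon> p (Gamma_N N \<pi>e)"
  proof (intro exI allI impI)
    fix N assume "N > N0"
    then have N: "N > 0" "N \<ge> N0" by auto
    interpret g: graph_game W C L D "E N" N "rho N" P r mu0 mu LP Lr M by (rule game[OF N(1)])
    have d_eq: "g.\<delta> = d N" and th_eq: "g.\<theta> = th N"
      by (simp_all add: g.\<delta>_def g.\<theta>_def d_def th_def)
    have Ipos: "I t x N \<ge> 0" and Jpos: "J t x N \<ge> 0" for t x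
      unfolding I_def J_def set_lebesgue_integral_def by (intro Bochner_Integration.integral_nonneg; simp)+
    have d_pos: "d N \<ge> 0" using g.\<delta>_nonneg d_eq by simp
    have step: "g.step_error t \<le> e N" if "t < T" for t
    proof -
      have "(\<Sum>k\<in>{1..N}. g.mf_error t k) / real N
          = (\<Sum>x\<in>UNIV. (\<Sum>k\<in>{1..N}. \<bar>(\<Sum>j\<in>{1..N}. g.A k j * mu t (real j / real N) x)
              - wint (\<lambda>b. mu t b x) (real k / real N)\<bar>) / real N)"
        unfolding g.mf_error_def g.G_def graphon_agg_eq_wint
        by (subst sum.swap) (simp add: sum_divide_distrib)
      also have "\<dots> \<le> (\<Sum>x\<in>UNIV. d N + C * I t x N + J t x N)"
        using g.average_mean_field_agg_close[OF mu_cont mu_abs] unfolding d_eq I_def J_def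
        by (intro sum_mono) auto
      also have "\<dots> \<le> (\<Sum>t<T. \<Sum>x\<in>UNIV. d N + C * I t x N + J t x N)"
        by (rule member_le_sum[of t "{..<T}" "\<lambda>t. \<Sum>x\<in>UNIV. d N + C * I t x N + J t x N"])
           (use that C_pos Ipos Jpos d_pos in \<open>auto intro!: sum_nonneg add_nonneg_nonneg\<close>)
      finally show ?thesis
        unfolding g.step_error_def e_def g.noise_def d_eq th_eq by simp
    qed
    let ?WN = "{k \<in> g.Good. g.return_bound T k \<le> \<epsilon> / 2}"
    have "real N - real (card ?WN) \<le> (d N / C + K * e N / (\<epsilon> / 2)) * real N"
      using g.card_large_return_bound[OF step, of T "\<epsilon> / 2"] \<epsilon> unfolding d_eq K_def by simp
    also have "\<dots> \<le> p * real N" using N0[OF N(2)] by (intro mult_right_mono) auto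
    finally have "(1 - p) * real N \<le> real (card ?WN)" by (simp add: algebra_simps)
    then have card: "of_int \<lfloor>(1 - p) * real N\<rfloor> \<le> real (card ?WN)" by linarith
    \<comment> \<open>Used both for the equilibrium profile and for each deviation, hence the
      tolerance \<open>\<epsilon> / 2\<close>. The set \<open>?WN\<close> was fixed without
      reference to \<open>pis\<close>, which gives the uniformity over deviating policies.\<close>
    have close: "\<bar>game_return P r mu0 (E N) (rho N) N T pis i
        - mf_return P r mu0 W T mu (real i / real N) (pis i)\<bar> \<le> \<epsilon> / 2"
      if i: "i \<in> ?WN" and pis: "\<And>k. k \<noteq> i \<Longrightarrow> pis k = \<pi>e (real k / real N)" for pis i
    proof -
      interpret dg: deviated_game W C L D "E N" N "rho N" P r mu0 mu LP Lr M pis i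
        using agent_law_eq_mf_flow[OF mu] mu g.grid_in_unit pis by unfold_locales simp
      show ?thesis using dg.return_close[of i T] i by (simp add: g.return_bound_def)
    qed
    show "markov_nash P r mu0 (E N) (rho N) N T \<epsilon> p (Gamma_N N \<pi>e)"
      unfolding markov_nash_def
    proof (intro exI[of _ ?WN] conjI ballI allI)
      show "?WN \<subseteq> {1..N}" by (auto simp: g.Good_def)
      show "real_of_int \<lfloor>(1 - p) * real N\<rfloor> \<le> real (card ?WN)" by (rule card)
      fix i pol assume i: "i \<in> ?WN"
      have iN: "real i / real N \<in> {0..1}" using i by (intro g.grid_in_unit) (simp add: g.Good_def)
      have "mf_return P r mu0 W T mu (real i / real N) pol
          \<le> mf_return P r mu0 W T mu (real i / real N) (\<pi>e (real i / real N))"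
        using gmfe iN unfolding is_GMFE_def by blast
      moreover have "\<bar>game_return P r mu0 (E N) (rho N) N T (Gamma_N N \<pi>e) i
        - mf_return P r mu0 W T mu (real i / real N) (\<pi>e (real i / real N))\<bar> \<le> \<epsilon> / 2"
        using close[OF i, of "Gamma_N N \<pi>e"] by (simp add: Gamma_N_def)
      moreover have "\<bar>game_return P r mu0 (E N) (rho N) N T ((Gamma_N N \<pi>e)(i := pol)) i
        - mf_return P r mu0 W T mu (real i / real N) pol\<bar> \<le> \<epsilon> / 2"
        using close[OF i, of "(Gamma_N N \<pi>e)(i := pol)"] by (simp add: Gamma_N_def)
      ultimately show "game_return P r mu0 (E N) (rho N) N T ((Gamma_N N \<pi>e)(i := pol)) i - \<epsilon>
          \<le> game_return P r mu0 (E N) (rho N) N T (Gamma_N N \<pi>e) i"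
        by linarith
    qed
  qed
qed

end
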